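(* Let $H_1, H_2$ be separable Hilbert spaces with compact embedding $H_1\subset\subset H_2$, let $(e_k)_{k\in\mathbb{N}}$, $(f_k)_{k\in\mathbb{N}}$, $(s_k)_{k\in\mathbb{N}}$ be a singular value decomposition of the inclusion $\mathrm{Id}:H_1\to H_2$ and let $F_n$ and $T_n$ be the associated finite dimensional subspaces and truncation operators, all as specified in the context. Consider on $H_1$ the stochastic partial differential equation $$dr_t = (Ar_t+\alpha(t,r_t))\,dt+\sigma(t,r_t)\,dW_t+\int_E\delta(t,r_{t-},\xi)\,(\mathfrak{p}(dt,d\xi)-\nu(d\xi)\,dt),\qquad r_0=h_0,$$ under the assumptions stated in the context. Let $(\epsilon_n)_{n\in\mathbb{N}}\subset(0,\infty)$ be an arbitrary decreasing sequence with $\epsilon_n\to0$. Then for every initial condition $h_0\in H_1$ there exists a sequence $(r^{(n)})_{n\in\mathbb{N}}$ of processes such that each $r^{(n)}$ is an $F_n$-valued Itô process and, almost surely, $$\|r^{(n)}_t-r_t\|_{H_2}\le\big(\|T_n-\mathrm{Id}\|+\epsilon_n\big)\|r_t\|_{H_1}\quad\text{for all } t\ge0 \text{ and } n \in \mathbb{N},$$ where $r$ denotes the weak solution with $r_0=h_0$; moreover, for every $t\ge 0$ the right-hand side converges to $0$ as $n\to\infty$.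
   Context: Embedding and finite-rank operators. $H_1\subset H_2$ with the inclusion $\mathrm{Id}:H_1\to H_2$ a compact linear operator. $(e_k)_{k\in\mathbb{N}}$ is an orthonormal system of $H_1$, $(f_k)_{k\in\mathbb{N}}$ an orthonormal system of $H_2$, and $(s_k)_{k\in\mathbb{N}}\subset\mathbb{R}_+$ a decreasing sequence with $s_k\to0$ such that $h=\sum_{k=1}^\infty s_k\langle h,e_k\rangle_{H_1}f_k$ for all $h\in H_1$ (convergence in $H_2$). Put $F_n:=\mathrm{span}\{f_1,\dots,f_n\}$ and $T_n:H_1\to F_n$, $T_nh:=\sum_{k=1}^n s_k\langle h,e_k\rangle_{H_1}f_k$. The operator norm of $T:H_1\to H_2$ is $\|T\|:=\sup_{\|h\|_{H_1}\le1}\|Th\|_{H_2}$. Stochastic equation. On a filtered probability space satisfying the usual conditions, $W$ is a Wiener process and $\mathfrak{p}$ is a homogeneous Poisson random measure on $\mathbb{R}_+\times E$ with compensator $dt\otimes\nu(d\xi)$, where $E$ is a mark space. $A$ is the generator of a strongly continuous semigroup on $H_1$, with adjoint $A^*$ and domain $\mathcal{D}(A^* )$. The measurable coefficients $\alpha$ ($H_1$-valued), $\sigma$ (with values in the Hilbert–Schmidt operators admissible as integrands for $W$) and $\delta$ ($H_1$-valued) are defined on $\mathbb{R}_+\times H_1$, $\mathbb{R}_+\times H_1$ and $\mathbb{R}_+\times H_1\times E$ respectively, and satisfy the standard Lipschitz and linear growth conditions: for every $T>0$ there is a constant $L_T$ such that for all $t\in[0,T]$ and $h,g\in H_1$ the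 quantities $\|\alpha(t,h)-\alpha(t,g)\|$, $\|\sigma(t,h)-\sigma(t,g)\|_{\mathrm{HS}}$, $\big(\int_E\|\delta(t,h,\xi)-\delta(t,g,\xi)\|^2\nu(d\xi)\big)^{1/2}$ are at most $L_T\|h-g\|$, and $\|\alpha(t,h)\|$, $\|\sigma(t,h)\|_{\mathrm{HS}}$, $\big(\int_E\|\delta(t,h,\xi)\|^2\nu(d\xi)\big)^{1/2}$ are at most $L_T(1+\|h\|)$. As a standing assumption, for each $h_0\in H_1$ there exists a unique weak solution $r$, i.e. an $H_1$-valued adapted càdlàg process such that for each $\zeta\in\mathcal{D}(A^* )$, almost surely, for all $t\ge0$, $$\langle\zeta,r_t\rangle_{H_1}=\langle\zeta,h_0\rangle_{H_1}+\int_0^t\big(\langle A^*\zeta,r_s\rangle_{H_1}+\langle\zeta,\alpha(s,r_s)\rangle_{H_1}\big)ds+\int_0^t\langle\zeta,\sigma(s,r_s)\rangle_{H_1}dW_s+\int_0^t\int_E\langle\zeta,\delta(s,r_{s-},\xi)\rangle_{H_1}(\mathfrak{p}(ds,d\xi)-\nu(d\xi)ds).$$ Itô process. An $F_n$-valued Itô process is a process of the form $x_0+\int_0^ta_s\,ds+\int_0^tb_s\,dW_s+\int_0^t\int_Ec_s(\xi)(\mathfrak{p}(ds,d\xi)-\nu(d\xi)ds)$, $t\ge0$, with $x_0\in F_n$ and $F_n$-valued (respectively operator-valued into $F_n$) integrands $a,b,c$ for which these integrals are defined. *)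

theory Defs
  imports "HOL-Analysis.Analysis" "HOL-Probability.Probability"
begin

section \<open>Compact embeddings and singular value decompositions\<close>

definition compact_operator :: "('a::real_normed_vector \<Rightarrow> 'b::real_normed_vector) \<Rightarrow> bool" where
  "compact_operator f \<longleftrightarrow>
     bounded_linear f \<and> (\<forall>B. bounded B \<longrightarrow> compact (closure (f ` B)))"

definition orthonormal_system :: "(nat \<Rightarrow> 'a::real_inner) \<Rightarrow> bool" where
  "orthonormal_system e \<longleftrightarrow> (\<forall>i j. inner (e i) (e j) = (if i = j then 1 else 0))"

text \<open>Sequences are indexed from 0: \<open>e k\<close>, \<open>f k\<close>, \<open>s k\<close> are the (k+1)-st terms of the sequences
  that mathematical texts number from 1. Hence the n-th subspace and the n-th truncation use the
  indices \<open>k < n\<close>.\<close>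

definition singular_value_decomposition ::
    "('a::real_inner \<Rightarrow> 'b::real_inner) \<Rightarrow> (nat \<Rightarrow> 'a) \<Rightarrow> (nat \<Rightarrow> 'b) \<Rightarrow> (nat \<Rightarrow> real) \<Rightarrow> bool" where
  "singular_value_decomposition \<iota> e f s \<longleftrightarrow>
     orthonormal_system e \<and> orthonormal_system f \<and>
     (\<forall>k. 0 \<le> s k) \<and> decseq s \<and> s \<longlonglongrightarrow> 0 \<and>
     (\<forall>h. (\<lambda>k. (s k * inner h (e k)) *\<^sub>R f k) sums \<iota> h)"

definition svd_space :: "(nat \<Rightarrow> 'b::real_inner) \<Rightarrow> nat \<Rightarrow> 'b set" where
  "svd_space f n = span (f ` {..<n})"

definition svd_truncation ::
    "(nat \<Rightarrow> 'a::real_inner) \<Rightarrow> (nat \<Rightarrow> 'b::real_inner) \<Rightarrow> (nat \<Rightarrow> real) \<Rightarrow> nat \<Rightarrow> 'a \<Rightarrow> 'b" where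
  "svd_truncation e f s n h = (\<Sum>k<n. (s k * inner h (e k)) *\<^sub>R f k)"

section \<open>Generators of strongly continuous semigroups and their adjoints\<close>

definition C0_semigroup :: "(real \<Rightarrow> 'h::real_normed_vector \<Rightarrow> 'h) \<Rightarrow> bool" where
  "C0_semigroup S \<longleftrightarrow>
     (\<forall>t\<ge>0. bounded_linear (S t)) \<and> (\<forall>h. S 0 h = h) \<and>
     (\<forall>t\<ge>0. \<forall>u\<ge>0. \<forall>h. S (t + u) h = S t (S u h)) \<and>
     (\<forall>h. ((\<lambda>t. S t h) \<longlongrightarrow> h) (at_right 0))"

text \<open>An unbounded operator is a pair of a domain \<open>D\<close> and a function \<open>A\<close> whose values outside \<open>D\<close>
  are irrelevant.\<close>

definition C0_generator :: "'h::real_normed_vector set \<Rightarrow> ('h \<Rightarrow> 'h) \<Rightarrow> bool" where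
  "C0_generator D A \<longleftrightarrow> (\<exists>S. C0_semigroup S \<and>
     D = {h. \<exists>l. ((\<lambda>t. (S t h - h) /\<^sub>R t) \<longlongrightarrow> l) (at_right 0)} \<and>
     (\<forall>h\<in>D. ((\<lambda>t. (S t h - h) /\<^sub>R t) \<longlongrightarrow> A h) (at_right 0)))"

definition adjoint_domain :: "'h::real_inner set \<Rightarrow> ('h \<Rightarrow> 'h) \<Rightarrow> 'h set" where
  "adjoint_domain D A = {\<zeta>. \<exists>\<eta>. \<forall>h\<in>D. inner (A h) \<zeta> = inner h \<eta>}"

text \<open>The vector below is unique because the domain of a generator is dense.\<close>

definition adjoint_operator :: "'h::real_inner set \<Rightarrow> ('h \<Rightarrow> 'h) \<Rightarrow> 'h \<Rightarrow> 'h" where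
  "adjoint_operator D A \<zeta> = (THE \<eta>. \<forall>h\<in>D. inner (A h) \<zeta> = inner h \<eta>)"

section \<open>Covariance operators and Hilbert--Schmidt operators\<close>

definition positive_operator :: "('u::real_inner \<Rightarrow> 'u) \<Rightarrow> bool" where
  "positive_operator R \<longleftrightarrow> bounded_linear R \<and>
     (\<forall>u v. inner (R u) v = inner u (R v)) \<and> (\<forall>u. 0 \<le> inner (R u) u)"

definition operator_sqrt :: "('u::real_inner \<Rightarrow> 'u) \<Rightarrow> 'u \<Rightarrow> 'u" where
  "operator_sqrt Q = (THE R. positive_operator R \<and> (\<forall>u. R (R u) = Q u))"

definition orthonormal_basis :: "'u::real_inner set \<Rightarrow> bool" where
  "orthonormal_basis B \<longleftrightarrow>
     (\<forall>u\<in>B. norm u = 1) \<and> pairwise orthogonal B \<and> closure (span B) = UNIV"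

text \<open>Traces of positive operators and Hilbert--Schmidt norms do not depend on the chosen basis.\<close>

definition some_orthonormal_basis :: "'u::real_inner set" where
  "some_orthonormal_basis = (SOME B. orthonormal_basis B)"

definition trace_class_covariance :: "('u::real_inner \<Rightarrow> 'u) \<Rightarrow> bool" where
  "trace_class_covariance Q \<longleftrightarrow> positive_operator Q \<and>
     (\<integral>\<^sup>+ u. ennreal (inner (Q u) u) \<partial>count_space some_orthonormal_basis) < \<infinity>"

text \<open>The integrands for a Q-Wiener process take values in the Hilbert--Schmidt operators from
  \<open>U\<^sub>0 = Q\<^sup>1\<^sup>/\<^sup>2 U\<close>, with the inner product that makes \<open>Q\<^sup>1\<^sup>/\<^sup>2\<close> a partial isometry onto \<open>U\<^sub>0\<close>.
  An operator \<open>L\<close> on \<open>U\<^sub>0\<close> is bounded, or Hilbert--Schmidt, iff \<open>L \<circ> Q\<^sup>1\<^sup>/\<^sup>2\<close> is so on \<open>U\<close>, with the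
  same Hilbert--Schmidt norm. Operators on \<open>U\<^sub>0\<close> are represented by functions on all of \<open>U\<close> of
  which only the values on \<open>U\<^sub>0\<close> matter.\<close>

definition hs_norm_sq ::
    "('u::real_inner \<Rightarrow> 'u) \<Rightarrow> ('u \<Rightarrow> 'h::real_normed_vector) \<Rightarrow> ennreal" where
  "hs_norm_sq Q L =
     (\<integral>\<^sup>+ u. ennreal ((norm (L (operator_sqrt Q u)))\<^sup>2) \<partial>count_space some_orthonormal_basis)"

definition hs_operators :: "('u::real_inner \<Rightarrow> 'u) \<Rightarrow> ('u \<Rightarrow> 'h::real_normed_vector) set" where
  "hs_operators Q =
     {L. bounded_linear (\<lambda>u. L (operator_sqrt Q u)) \<and> hs_norm_sq Q L < \<infinity>}"

section \<open>Filtrations and processes\<close>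

text \<open>The time set is \<open>{0..}\<close>; values of filtrations and processes at negative times are irrelevant.\<close>

definition usual_conditions :: "'w measure \<Rightarrow> (real \<Rightarrow> 'w measure) \<Rightarrow> bool" where
  "usual_conditions M F \<longleftrightarrow> prob_space M \<and>
     (\<forall>t\<ge>0. subalgebra M (F t)) \<and>
     (\<forall>s t. 0 \<le> s \<and> s \<le> t \<longrightarrow> sets (F s) \<subseteq> sets (F t)) \<and>
     (\<forall>t\<ge>0. sets (F t) = (\<Inter>u\<in>{t<..}. sets (F u))) \<and>
     (\<forall>N\<in>null_sets M. \<forall>A\<subseteq>N. A \<in> sets (F 0))"

definition adapted ::
    "(real \<Rightarrow> 'w measure) \<Rightarrow> (real \<Rightarrow> 'w \<Rightarrow> 'h::topological_space) \<Rightarrow> bool" where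
  "adapted F X \<longleftrightarrow> (\<forall>t\<ge>0. X t \<in> borel_measurable (F t))"

definition cadlag :: "(real \<Rightarrow> 'h::topological_space) \<Rightarrow> bool" where
  "cadlag x \<longleftrightarrow> (\<forall>t\<ge>0. (x \<longlongrightarrow> x t) (at_right t)) \<and> (\<forall>t>0. \<exists>l. (x \<longlongrightarrow> l) (at_left t))"

definition left_limit :: "(real \<Rightarrow> 'h::t2_space) \<Rightarrow> real \<Rightarrow> 'h" where
  "left_limit x t = (if t \<le> 0 then x 0 else Lim (at_left t) x)"

definition progressive ::
    "(real \<Rightarrow> 'w measure) \<Rightarrow> (real \<Rightarrow> 'w \<Rightarrow> 'h::topological_space) \<Rightarrow> bool" where
  "progressive F X \<longleftrightarrow>
     (\<forall>T\<ge>0. (\<lambda>(s, \<omega>). X s \<omega>) \<in> borel_measurable (restrict_space borel {0..T} \<Otimes>\<^sub>M F T))"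

definition predictable_algebra ::
    "'w measure \<Rightarrow> (real \<Rightarrow> 'w measure) \<Rightarrow> (real \<times> 'w) measure" where
  "predictable_algebra M F = sigma ({0..} \<times> space M)
     ({{0} \<times> A |A. A \<in> sets (F 0)} \<union>
      {{a<..b} \<times> A |a b A. 0 \<le> a \<and> a \<le> b \<and> A \<in> sets (F a)})"

section \<open>Wiener processes and Poisson random measures\<close>

definition centered_normal :: "real \<Rightarrow> real measure" where
  "centered_normal v =
     (if v = 0 then return borel 0 else density lborel (\<lambda>x. ennreal (normal_density 0 (sqrt v) x)))"

definition wiener_process ::
    "'w measure \<Rightarrow> (real \<Rightarrow> 'w measure) \<Rightarrow> ('u::real_inner \<Rightarrow> 'u) \<Rightarrow>
     (real \<Rightarrow> 'w \<Rightarrow> 'u) \<Rightarrow> bool" where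
  "wiener_process M F Q W \<longleftrightarrow>
     trace_class_covariance Q \<and> adapted F W \<and>
     (\<forall>\<omega>\<in>space M. W 0 \<omega> = 0 \<and> continuous_on {0..} (\<lambda>t. W t \<omega>)) \<and>
     (\<forall>s t. 0 \<le> s \<and> s < t \<longrightarrow>
        prob_space.indep_set M (sets (F s))
          {(\<lambda>\<omega>. W t \<omega> - W s \<omega>) -` B \<inter> space M |B. B \<in> sets borel} \<and>
        (\<forall>u. distr M borel (\<lambda>\<omega>. inner u (W t \<omega> - W s \<omega>)) =
          centered_normal ((t - s) * inner (Q u) u)))"

definition poisson_variable :: "'w measure \<Rightarrow> ('w \<Rightarrow> ennreal) \<Rightarrow> real \<Rightarrow> bool" where
  "poisson_variable M N c \<longleftrightarrow> N \<in> borel_measurable M \<and>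
     (\<forall>k. measure M {\<omega> \<in> space M. N \<omega> = of_nat k} = exp (- c) * c ^ k / fact k)"

abbreviation time_mark_algebra :: "'x measure \<Rightarrow> (real \<times> 'x) measure" where
  "time_mark_algebra \<nu> \<equiv> restrict_space lborel {0..} \<Otimes>\<^sub>M \<nu>"

text \<open>As a measure, \<open>time_mark_algebra \<nu>\<close> is the compensator \<open>dt \<otimes> \<nu>(d\<xi>)\<close>.\<close>

definition poisson_random_measure ::
    "'w measure \<Rightarrow> (real \<Rightarrow> 'w measure) \<Rightarrow> 'x measure \<Rightarrow>
     ('w \<Rightarrow> (real \<times> 'x) measure) \<Rightarrow> bool" where
  "poisson_random_measure M F \<nu> p \<longleftrightarrow>
     sigma_finite_measure \<nu> \<and>
     (\<forall>\<omega>\<in>space M. sets (p \<omega>) = sets (time_mark_algebra \<nu>) \<and>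
        (\<forall>A\<in>sets (time_mark_algebra \<nu>). emeasure (p \<omega>) A \<in> \<nat> \<union> {\<infinity>})) \<and>
     (\<forall>A\<in>sets (time_mark_algebra \<nu>). (\<lambda>\<omega>. emeasure (p \<omega>) A) \<in> borel_measurable M) \<and>
     (\<forall>A\<in>sets (time_mark_algebra \<nu>). emeasure (time_mark_algebra \<nu>) A < \<infinity> \<longrightarrow>
        poisson_variable M (\<lambda>\<omega>. emeasure (p \<omega>) A) (measure (time_mark_algebra \<nu>) A)) \<and>
     (\<forall>m. \<forall>A :: nat \<Rightarrow> (real \<times> 'x) set.
        (\<forall>i<m. A i \<in> sets (time_mark_algebra \<nu>)) \<and> disjoint_family_on A {..<m} \<longrightarrow>
        prob_space.indep_vars M (\<lambda>_. borel) (\<lambda>i \<omega>. emeasure (p \<omega>) (A i)) {..<m}) \<and>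
     (\<forall>t\<ge>0. \<forall>A\<in>sets (time_mark_algebra \<nu>). A \<subseteq> {0..t} \<times> space \<nu> \<longrightarrow>
        (\<lambda>\<omega>. emeasure (p \<omega>) A) \<in> borel_measurable (F t)) \<and>
     (\<forall>t\<ge>0. prob_space.indep_set M (sets (F t))
        (sigma_sets (space M)
          {(\<lambda>\<omega>. emeasure (p \<omega>) A) -` B \<inter> space M |A B.
             A \<in> sets (time_mark_algebra \<nu>) \<and> A \<subseteq> {t<..} \<times> space \<nu> \<and> B \<in> sets borel}))"

section \<open>Stochastic integrals\<close>

text \<open>Stochastic integrals are extended from elementary integrands, and are characterised as
  relations: a process is a stochastic integral of an integrand iff it is the almost sure limit,
  uniformly on compact time intervals, of the integrals of elementary integrands that almost surely
  approximate the integrand in the square norm on each compact time interval. For every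
  progressive (respectively predictable) integrand which is almost surely locally square integrable
  there is such a process, and it is unique up to indistinguishability; convergence in probability
  is the same as almost sure convergence after passing to a subsequence.

  An elementary integrand for the Wiener process is a finite sum of terms
  \<open>1\<^bsub>A\<^esub>(\<omega>) 1\<^bsub>(a,b]\<^esub>(s) L\<close> with \<open>A\<close> in the sigma-algebra at time \<open>a\<close> and \<open>L\<close> a bounded
  linear operator.\<close>

type_synonym ('w, 'u, 'h) elementary_wiener = "(real \<times> real \<times> 'w set \<times> ('u \<Rightarrow>\<^sub>L 'h)) list"

definition elementary_wiener ::
    "(real \<Rightarrow> 'w measure) \<Rightarrow>
     ('w, 'u::real_normed_vector, 'h::real_normed_vector) elementary_wiener \<Rightarrow> bool" where
  "elementary_wiener F \<phi> \<longleftrightarrow> (\<forall>(a, b, A, L)\<in>set \<phi>. 0 \<le> a \<and> a \<le> b \<and> A \<in> sets (F a))"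

definition elementary_wiener_fun ::
    "('w, 'u::real_normed_vector, 'h::real_normed_vector) elementary_wiener \<Rightarrow>
     real \<Rightarrow> 'w \<Rightarrow> 'u \<Rightarrow> 'h" where
  "elementary_wiener_fun \<phi> s \<omega> u =
     (\<Sum>(a, b, A, L)\<leftarrow>\<phi>. (indicator A \<omega> * indicator {a<..b} s :: real) *\<^sub>R blinfun_apply L u)"

definition elementary_wiener_integral ::
    "(real \<Rightarrow> 'w \<Rightarrow> 'u) \<Rightarrow>
     ('w, 'u::real_normed_vector, 'h::real_normed_vector) elementary_wiener \<Rightarrow>
     real \<Rightarrow> 'w \<Rightarrow> 'h" where
  "elementary_wiener_integral W \<phi> t \<omega> =
     (\<Sum>(a, b, A, L)\<leftarrow>\<phi>.
        (indicator A \<omega> :: real) *\<^sub>R blinfun_apply L (W (min t b) \<omega> - W (min t a) \<omega>))"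

text \<open>Measurability with respect to the Borel sets of the separable Hilbert space of
  Hilbert--Schmidt operators is strong measurability.\<close>

definition wiener_integrand ::
    "'w measure \<Rightarrow> (real \<Rightarrow> 'w measure) \<Rightarrow> ('u::real_inner \<Rightarrow> 'u) \<Rightarrow>
     (real \<Rightarrow> 'w \<Rightarrow> 'u \<Rightarrow> 'h::real_normed_vector) \<Rightarrow> bool" where
  "wiener_integrand M F Q \<Phi> \<longleftrightarrow>
     (\<forall>s\<ge>0. \<forall>\<omega>\<in>space M. \<Phi> s \<omega> \<in> hs_operators Q) \<and>
     (\<forall>u. progressive F (\<lambda>s \<omega>. \<Phi> s \<omega> (operator_sqrt Q u))) \<and>
     (AE \<omega> in M. \<forall>T\<ge>0. (\<integral>\<^sup>+ s\<in>{0..T}. hs_norm_sq Q (\<Phi> s \<omega>) \<partial>lborel) < \<infinity>)"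

definition wiener_integral ::
    "'w measure \<Rightarrow> (real \<Rightarrow> 'w measure) \<Rightarrow> ('u::real_inner \<Rightarrow> 'u) \<Rightarrow>
     (real \<Rightarrow> 'w \<Rightarrow> 'u) \<Rightarrow>
     (real \<Rightarrow> 'w \<Rightarrow> 'u \<Rightarrow> 'h::real_normed_vector) \<Rightarrow> (real \<Rightarrow> 'w \<Rightarrow> 'h) \<Rightarrow> bool" where
  "wiener_integral M F Q W \<Phi> X \<longleftrightarrow>
     wiener_integrand M F Q \<Phi> \<and> adapted F X \<and>
     (\<forall>\<omega>\<in>space M. continuous_on {0..} (\<lambda>t. X t \<omega>)) \<and>
     (\<exists>\<phi> :: nat \<Rightarrow> ('w, 'u, 'h) elementary_wiener.
        (\<forall>n. elementary_wiener F (\<phi> n)) \<and>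
        (AE \<omega> in M. \<forall>T\<ge>0.
           (\<lambda>n. \<integral>\<^sup>+ s\<in>{0..T}.
              hs_norm_sq Q (\<lambda>u. elementary_wiener_fun (\<phi> n) s \<omega> u - \<Phi> s \<omega> u) \<partial>lborel)
             \<longlonglongrightarrow> 0) \<and>
        (AE \<omega> in M. \<forall>T\<ge>0.
           uniform_limit {0..T} (\<lambda>n t. elementary_wiener_integral W (\<phi> n) t \<omega>)
             (\<lambda>t. X t \<omega>) sequentially))"

text \<open>An elementary integrand for the compensated Poisson random measure is a finite sum of terms
  \<open>1\<^bsub>A\<^esub>(\<omega>) 1\<^bsub>(a,b]\<^esub>(s) 1\<^bsub>B\<^esub>(\<xi>) v\<close> where \<open>\<nu>(B)\<close> is finite. The random measure is almost surely
  finite on \<open>(a,b] \<times> B\<close>, so that taking its real value below is harmless.\<close>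

type_synonym ('w, 'x, 'h) elementary_poisson = "(real \<times> real \<times> 'w set \<times> 'x set \<times> 'h) list"

definition elementary_poisson ::
    "(real \<Rightarrow> 'w measure) \<Rightarrow> 'x measure \<Rightarrow>
     ('w, 'x, 'h::real_normed_vector) elementary_poisson \<Rightarrow> bool" where
  "elementary_poisson F \<nu> \<phi> \<longleftrightarrow>
     (\<forall>(a, b, A, B, v)\<in>set \<phi>. 0 \<le> a \<and> a \<le> b \<and> A \<in> sets (F a) \<and>
        B \<in> sets \<nu> \<and> emeasure \<nu> B < \<infinity>)"

definition elementary_poisson_fun ::
    "('w, 'x, 'h::real_normed_vector) elementary_poisson \<Rightarrow> real \<Rightarrow> 'w \<Rightarrow> 'x \<Rightarrow> 'h" where
  "elementary_poisson_fun \<phi> s \<omega> \<xi> =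
     (\<Sum>(a, b, A, B, v)\<leftarrow>\<phi>. (indicator A \<omega> * indicator {a<..b} s * indicator B \<xi> :: real) *\<^sub>R v)"

definition elementary_poisson_integral ::
    "'x measure \<Rightarrow> ('w \<Rightarrow> (real \<times> 'x) measure) \<Rightarrow>
     ('w, 'x, 'h::real_normed_vector) elementary_poisson \<Rightarrow> real \<Rightarrow> 'w \<Rightarrow> 'h" where
  "elementary_poisson_integral \<nu> p \<phi> t \<omega> =
     (\<Sum>(a, b, A, B, v)\<leftarrow>\<phi>.
        (indicator A \<omega> * (measure (p \<omega>) ({min t a<..min t b} \<times> B)
           - (min t b - min t a) * measure \<nu> B)) *\<^sub>R v)"

definition poisson_integrand ::
    "'w measure \<Rightarrow> (real \<Rightarrow> 'w measure) \<Rightarrow> 'x measure \<Rightarrow>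
     (real \<Rightarrow> 'w \<Rightarrow> 'x \<Rightarrow> 'h::real_normed_vector) \<Rightarrow> bool" where
  "poisson_integrand M F \<nu> c \<longleftrightarrow>
     (\<lambda>((s, \<omega>), \<xi>). c s \<omega> \<xi>) \<in> borel_measurable (predictable_algebra M F \<Otimes>\<^sub>M \<nu>) \<and>
     (AE \<omega> in M. \<forall>T\<ge>0.
        (\<integral>\<^sup>+ s\<in>{0..T}. (\<integral>\<^sup>+ \<xi>. ennreal ((norm (c s \<omega> \<xi>))\<^sup>2) \<partial>\<nu>) \<partial>lborel) < \<infinity>)"

definition poisson_integral ::
    "'w measure \<Rightarrow> (real \<Rightarrow> 'w measure) \<Rightarrow> 'x measure \<Rightarrow>
     ('w \<Rightarrow> (real \<times> 'x) measure) \<Rightarrow>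
     (real \<Rightarrow> 'w \<Rightarrow> 'x \<Rightarrow> 'h::real_normed_vector) \<Rightarrow> (real \<Rightarrow> 'w \<Rightarrow> 'h) \<Rightarrow> bool" where
  "poisson_integral M F \<nu> p c X \<longleftrightarrow>
     poisson_integrand M F \<nu> c \<and> adapted F X \<and>
     (\<forall>\<omega>\<in>space M. cadlag (\<lambda>t. X t \<omega>)) \<and>
     (\<exists>\<phi> :: nat \<Rightarrow> ('w, 'x, 'h) elementary_poisson.
        (\<forall>n. elementary_poisson F \<nu> (\<phi> n)) \<and>
        (AE \<omega> in M. \<forall>T\<ge>0.
           (\<lambda>n. \<integral>\<^sup>+ s\<in>{0..T}. (\<integral>\<^sup>+ \<xi>.
              ennreal ((norm (elementary_poisson_fun (\<phi> n) s \<omega> \<xi> - c s \<omega> \<xi>))\<^sup>2) \<partial>\<nu>) \<partial>lborel)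
             \<longlonglongrightarrow> 0) \<and>
        (AE \<omega> in M. \<forall>T\<ge>0.
           uniform_limit {0..T} (\<lambda>n t. elementary_poisson_integral \<nu> p (\<phi> n) t \<omega>)
             (\<lambda>t. X t \<omega>) sequentially))"

definition drift_integrand ::
    "'w measure \<Rightarrow> (real \<Rightarrow> 'w measure) \<Rightarrow>
     (real \<Rightarrow> 'w \<Rightarrow> 'h::{banach, second_countable_topology}) \<Rightarrow> bool" where
  "drift_integrand M F a \<longleftrightarrow> progressive F a \<and>
     (AE \<omega> in M. \<forall>T\<ge>0. set_integrable lborel {0..T} (\<lambda>s. a s \<omega>))"

section \<open>Ito processes and weak solutions\<close>

definition ito_representation ::
    "'w measure \<Rightarrow> (real \<Rightarrow> 'w measure) \<Rightarrow> ('u::real_inner \<Rightarrow> 'u) \<Rightarrow>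
     (real \<Rightarrow> 'w \<Rightarrow> 'u) \<Rightarrow> 'x measure \<Rightarrow> ('w \<Rightarrow> (real \<times> 'x) measure) \<Rightarrow>
     'h::{banach, second_countable_topology} \<Rightarrow> (real \<Rightarrow> 'w \<Rightarrow> 'h) \<Rightarrow>
     (real \<Rightarrow> 'w \<Rightarrow> 'u \<Rightarrow> 'h) \<Rightarrow> (real \<Rightarrow> 'w \<Rightarrow> 'x \<Rightarrow> 'h) \<Rightarrow>
     (real \<Rightarrow> 'w \<Rightarrow> 'h) \<Rightarrow> bool" where
  "ito_representation M F Q W \<nu> p x0 a b c X \<longleftrightarrow>
     drift_integrand M F a \<and>
     (\<exists>Y Z. wiener_integral M F Q W b Y \<and> poisson_integral M F \<nu> p c Z \<and>
        (AE \<omega> in M. \<forall>t\<ge>0. X t \<omega> = x0 + (LINT s:{0..t}|lborel. a s \<omega>) + Y t \<omega> + Z t \<omega>))"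

definition ito_process ::
    "'w measure \<Rightarrow> (real \<Rightarrow> 'w measure) \<Rightarrow> ('u::real_inner \<Rightarrow> 'u) \<Rightarrow>
     (real \<Rightarrow> 'w \<Rightarrow> 'u) \<Rightarrow> 'x measure \<Rightarrow> ('w \<Rightarrow> (real \<times> 'x) measure) \<Rightarrow>
     'h::{banach, second_countable_topology} set \<Rightarrow> (real \<Rightarrow> 'w \<Rightarrow> 'h) \<Rightarrow> bool" where
  "ito_process M F Q W \<nu> p V X \<longleftrightarrow>
     (\<forall>t\<ge>0. \<forall>\<omega>\<in>space M. X t \<omega> \<in> V) \<and>
     (\<exists>x0 a b c.
        x0 \<in> V \<and>
        (\<forall>s\<ge>0. \<forall>\<omega>\<in>space M. a s \<omega> \<in> V) \<and>
        (\<forall>s\<ge>0. \<forall>\<omega>\<in>space M. \<forall>u. b s \<omega> (operator_sqrt Q u) \<in> V) \<and>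
        (\<forall>s\<ge>0. \<forall>\<omega>\<in>space M. \<forall>\<xi>\<in>space \<nu>. c s \<omega> \<xi> \<in> V) \<and>
        ito_representation M F Q W \<nu> p x0 a b c X)"

definition weak_solution ::
    "'w measure \<Rightarrow> (real \<Rightarrow> 'w measure) \<Rightarrow> ('u::real_inner \<Rightarrow> 'u) \<Rightarrow>
     (real \<Rightarrow> 'w \<Rightarrow> 'u) \<Rightarrow> 'x measure \<Rightarrow> ('w \<Rightarrow> (real \<times> 'x) measure) \<Rightarrow>
     'h set \<Rightarrow> ('h \<Rightarrow> 'h) \<Rightarrow> (real \<Rightarrow> 'h \<Rightarrow> 'h) \<Rightarrow> (real \<Rightarrow> 'h \<Rightarrow> 'u \<Rightarrow> 'h) \<Rightarrow>
     (real \<Rightarrow> 'h \<Rightarrow> 'x \<Rightarrow> 'h) \<Rightarrow> 'h::{real_inner, banach, second_countable_topology} \<Rightarrow>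
     (real \<Rightarrow> 'w \<Rightarrow> 'h) \<Rightarrow> bool" where
  "weak_solution M F Q W \<nu> p D A \<alpha> \<sigma> \<delta> h0 r \<longleftrightarrow>
     adapted F r \<and> (\<forall>\<omega>\<in>space M. cadlag (\<lambda>t. r t \<omega>)) \<and>
     (\<forall>\<zeta>\<in>adjoint_domain D A.
        ito_representation M F Q W \<nu> p (inner \<zeta> h0)
          (\<lambda>s \<omega>. inner (adjoint_operator D A \<zeta>) (r s \<omega>) + inner \<zeta> (\<alpha> s (r s \<omega>)))
          (\<lambda>s \<omega> u. inner \<zeta> (\<sigma> s (r s \<omega>) u))
          (\<lambda>s \<omega> \<xi>. inner \<zeta> (\<delta> s (left_limit (\<lambda>t. r t \<omega>) s) \<xi>))
          (\<lambda>t \<omega>. inner \<zeta> (r t \<omega>)))"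

definition unique_weak_solutions ::
    "'w measure \<Rightarrow> (real \<Rightarrow> 'w measure) \<Rightarrow> ('u::real_inner \<Rightarrow> 'u) \<Rightarrow>
     (real \<Rightarrow> 'w \<Rightarrow> 'u) \<Rightarrow> 'x measure \<Rightarrow> ('w \<Rightarrow> (real \<times> 'x) measure) \<Rightarrow>
     'h set \<Rightarrow> ('h \<Rightarrow> 'h) \<Rightarrow> (real \<Rightarrow> 'h \<Rightarrow> 'h) \<Rightarrow> (real \<Rightarrow> 'h \<Rightarrow> 'u \<Rightarrow> 'h) \<Rightarrow>
     (real \<Rightarrow> 'h::{real_inner, banach, second_countable_topology} \<Rightarrow> 'x \<Rightarrow> 'h) \<Rightarrow> bool" where
  "unique_weak_solutions M F Q W \<nu> p D A \<alpha> \<sigma> \<delta> \<longleftrightarrow>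
     (\<forall>h0. (\<exists>r. weak_solution M F Q W \<nu> p D A \<alpha> \<sigma> \<delta> h0 r) \<and>
        (\<forall>r r'. weak_solution M F Q W \<nu> p D A \<alpha> \<sigma> \<delta> h0 r \<and>
                weak_solution M F Q W \<nu> p D A \<alpha> \<sigma> \<delta> h0 r' \<longrightarrow>
                (AE \<omega> in M. \<forall>t\<ge>0. r t \<omega> = r' t \<omega>)))"

section \<open>Coefficients\<close>

definition measurable_coefficients ::
    "('u::real_inner \<Rightarrow> 'u) \<Rightarrow> 'x measure \<Rightarrow>
     (real \<Rightarrow> 'h \<Rightarrow> 'h) \<Rightarrow> (real \<Rightarrow> 'h \<Rightarrow> 'u \<Rightarrow> 'h) \<Rightarrow>
     (real \<Rightarrow> 'h::real_normed_vector \<Rightarrow> 'x \<Rightarrow> 'h) \<Rightarrow> bool" where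
  "measurable_coefficients Q \<nu> \<alpha> \<sigma> \<delta> \<longleftrightarrow>
     (\<lambda>(t, h). \<alpha> t h) \<in> borel_measurable (restrict_space borel {0..} \<Otimes>\<^sub>M borel) \<and>
     (\<forall>t\<ge>0. \<forall>h. \<sigma> t h \<in> hs_operators Q) \<and>
     (\<forall>u. (\<lambda>(t, h). \<sigma> t h (operator_sqrt Q u))
        \<in> borel_measurable (restrict_space borel {0..} \<Otimes>\<^sub>M borel)) \<and>
     (\<lambda>((t, h), \<xi>). \<delta> t h \<xi>) \<in> borel_measurable ((restrict_space borel {0..} \<Otimes>\<^sub>M borel) \<Otimes>\<^sub>M \<nu>)"

text \<open>The bounds on Hilbert--Schmidt norms and on L2-norms with respect to \<open>\<nu>\<close> are squared, so that
  they can be stated for extended nonnegative numbers and include finiteness.\<close>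

definition lipschitz_coefficients ::
    "('u::real_inner \<Rightarrow> 'u) \<Rightarrow> 'x measure \<Rightarrow>
     (real \<Rightarrow> 'h \<Rightarrow> 'h) \<Rightarrow> (real \<Rightarrow> 'h \<Rightarrow> 'u \<Rightarrow> 'h) \<Rightarrow>
     (real \<Rightarrow> 'h::real_normed_vector \<Rightarrow> 'x \<Rightarrow> 'h) \<Rightarrow> bool" where
  "lipschitz_coefficients Q \<nu> \<alpha> \<sigma> \<delta> \<longleftrightarrow>
     (\<forall>T>0. \<exists>L\<ge>0. \<forall>t\<in>{0..T}. \<forall>h g.
        norm (\<alpha> t h - \<alpha> t g) \<le> L * norm (h - g) \<and>
        hs_norm_sq Q (\<lambda>u. \<sigma> t h u - \<sigma> t g u) \<le> ennreal ((L * norm (h - g))\<^sup>2) \<and>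
        (\<integral>\<^sup>+ \<xi>. ennreal ((norm (\<delta> t h \<xi> - \<delta> t g \<xi>))\<^sup>2) \<partial>\<nu>) \<le> ennreal ((L * norm (h - g))\<^sup>2) \<and>
        norm (\<alpha> t h) \<le> L * (1 + norm h) \<and>
        hs_norm_sq Q (\<sigma> t h) \<le> ennreal ((L * (1 + norm h))\<^sup>2) \<and>
        (\<integral>\<^sup>+ \<xi>. ennreal ((norm (\<delta> t h \<xi>))\<^sup>2) \<partial>\<nu>) \<le> ennreal ((L * (1 + norm h))\<^sup>2))"

end

theory Submission
  imports Defs
begin

text \<open>The weak formulation of the equation makes \<open>inner \<zeta> (r t)\<close> a real-valued Ito process for each
  \<open>\<zeta>\<close> in the domain of the adjoint of \<open>A\<close>. The truncation of \<open>r t\<close> after \<open>n\<close> terms, the sum over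
  \<open>k < n\<close> of \<open>(s k * inner (r t) (e k)) *\<^sub>R f k\<close>, would therefore be an Ito process if the vectors \<open>e k\<close> were in
  that domain. They need not be, but the domain is dense (\<open>C0_generator_adjoint_domain_dense\<close>), and
  each \<open>e k\<close> can be replaced by some \<open>\<zeta> n k\<close> of the domain that is so close that the total error, by
  Cauchy--Schwarz, is at most \<open>\<epsilon> n * norm (r t)\<close>. The bound then holds for every path and every
  time. Its right-hand side tends to 0 because the operator norm of the truncation error is at
  most \<open>s n\<close>, by Bessel's inequality (\<open>svd_truncation_error\<close>).

  Density of the adjoint domain rests on two facts: the closure of the graph of a generator
  contains no \<open>(0, x)\<close> with \<open>x \<noteq> 0\<close> (\<open>C0_generator_closable\<close>), and points of a Hilbert space have
  orthogonal projections onto closed subspaces (\<open>orthogonal_projection_exists\<close>), which is applied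
  both to the given space and to its product with itself.

  That Ito processes are preserved by bounded linear operators and by sums
  (\<open>ito_representation_blinfun_image\<close>, \<open>ito_representation_add\<close>) takes an argument, because
  stochastic integrals are characterised as limits of integrals of elementary integrands. The transformed
  elementary integrands approximate the transformed integrand; the estimates of their square
  norms need measurability of these norms in the time variable, which for the Wiener integral
  comes from the existence and countability of orthonormal bases.\<close>

section \<open>Orthogonal projections in Hilbert spaces\<close>

lemma orthogonal_projection_exists:
  fixes C :: "'a::{real_inner, banach} set"
  assumes C: "subspace C" "closed C"
  obtains c where "c \<in> C" "\<And>y. y \<in> C \<Longrightarrow> inner (x - c) y = 0"
proof -
  define S where "S = (\<lambda>c. (norm (x - c))\<^sup>2) ` C"
  define d where "d = Inf S"
  have S: "S \<noteq> {}" "bdd_below S"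
    using subspace_0[OF C(1)] by (auto simp: S_def intro!: bdd_belowI[where m = 0])
  have d_le: "d \<le> (norm (x - c))\<^sup>2" if "c \<in> C" for c
    unfolding d_def by (rule cInf_lower) (use that S in \<open>auto simp: S_def\<close>)
  have "\<exists>c\<in>C. (norm (x - c))\<^sup>2 < d + inverse (real (Suc n))" for n
    using cInf_lessD[OF S(1), of "d + inverse (real (Suc n))"] by (auto simp: d_def S_def)
  then obtain c where c: "\<And>n. c n \<in> C" "\<And>n. (norm (x - c n))\<^sup>2 < d + inverse (real (Suc n))"
    by metis
  \<comment> \<open>the parallelogram law makes a minimising sequence Cauchy\<close>
  have par: "(norm (c m - c n))\<^sup>2 < 2 * inverse (real (Suc m)) + 2 * inverse (real (Suc n))" for m n
  proof -
    have "(norm (c m - c n))\<^sup>2 = 2 * (norm (x - c m))\<^sup>2 + 2 * (norm (x - c n))\<^sup>2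
        - 4 * (norm (x - (1/2) *\<^sub>R (c m + c n)))\<^sup>2"
      by (simp add: power2_norm_eq_inner inner_simps inner_commute algebra_simps)
    moreover have "d \<le> (norm (x - (1/2) *\<^sub>R (c m + c n)))\<^sup>2"
      by (intro d_le subspace_scale subspace_add C c)
    ultimately show ?thesis using c(2)[of m] c(2)[of n] by linarith
  qed
  have "Cauchy c"
  proof (rule metric_CauchyI)
    fix e :: real assume "0 < e"
    then obtain N where N: "inverse (real (Suc N)) < e\<^sup>2 / 4"
      using reals_Archimedean[of "e\<^sup>2 / 4"] by auto
    have inv: "inverse (real (Suc m)) < e\<^sup>2 / 4" if "m \<ge> N" for m
      by (rule le_less_trans[OF _ N]) (use that in \<open>simp add: field_simps\<close>)
    have "norm (c m - c n) < e" if "m \<ge> N" "n \<ge> N" for m n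
    proof (rule power_less_imp_less_base[where n = 2])
      show "(norm (c m - c n))\<^sup>2 < e\<^sup>2"
        using par[of m n] inv[OF that(1)] inv[OF that(2)] by linarith
    qed (use \<open>0 < e\<close> in simp)
    then show "\<exists>N. \<forall>m\<ge>N. \<forall>n\<ge>N. dist (c m) (c n) < e"
      by (auto simp: dist_norm)
  qed
  then obtain p where p: "c \<longlonglongrightarrow> p"
    using Cauchy_convergent_iff convergent_def by blast
  have pC: "p \<in> C"
    using C(2) c(1) p closed_sequentially by blast
  have "(\<lambda>n. (norm (x - c n))\<^sup>2) \<longlonglongrightarrow> (norm (x - p))\<^sup>2"
    by (intro tendsto_intros p)
  moreover have "(\<lambda>n. d + inverse (real (Suc n))) \<longlonglongrightarrow> d"
    using tendsto_add[OF tendsto_const LIMSEQ_inverse_real_of_nat, of d] by simp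
  ultimately have pd: "(norm (x - p))\<^sup>2 \<le> d"
  proof (rule LIMSEQ_le)
    show "\<exists>N. \<forall>n\<ge>N. (norm (x - c n))\<^sup>2 \<le> d + inverse (real (Suc n))"
      using c(2) less_imp_le by blast
  qed
  have "inner (x - p) y = 0" if y: "y \<in> C" for y
  proof (cases "y = 0")
    case False
    \<comment> \<open>\<open>p + t *\<^sub>R y\<close> is the point closest to \<open>x\<close> on the line through \<open>p\<close> in direction \<open>y\<close>\<close>
    define t where "t = inner (x - p) y / (norm y)\<^sup>2"
    have "d \<le> (norm (x - (p + t *\<^sub>R y)))\<^sup>2"
      by (intro d_le subspace_add subspace_scale C pC y)
    also have "\<dots> = (norm (x - p))\<^sup>2 - 2 * t * inner (x - p) y + t\<^sup>2 * (norm y)\<^sup>2"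
      unfolding power2_norm_eq_inner
      by (simp add: inner_simps inner_commute power2_eq_square algebra_simps)
    also have "\<dots> = (norm (x - p))\<^sup>2 - (inner (x - p) y)\<^sup>2 / (norm y)\<^sup>2"
      using False by (simp add: t_def power2_eq_square field_simps)
    finally have "(inner (x - p) y)\<^sup>2 / (norm y)\<^sup>2 \<le> 0"
      using pd by linarith
    then show ?thesis
      using False by (auto simp: divide_le_0_iff power2_eq_square mult_le_0_iff)
  qed simp
  with pC show ?thesis by (rule that)
qed

lemma subspace_closure:
  fixes C :: "'a::real_normed_vector set"
  assumes "subspace C"
  shows "subspace (closure C)"
  unfolding subspace_def
proof (intro conjI ballI allI)
  show "0 \<in> closure C"
    using subspace_0[OF assms] closure_subset by blast
  fix x y assume "x \<in> closure C" "y \<in> closure C"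
  then obtain f g where fg: "\<And>n. f n \<in> C" "f \<longlonglongrightarrow> x" "\<And>n. g n \<in> C" "g \<longlonglongrightarrow> y"
    unfolding closure_sequential by blast
  have "(\<lambda>n. f n + g n) \<longlonglongrightarrow> x + y" by (intro tendsto_add fg)
  then show "x + y \<in> closure C"
    unfolding closure_sequential
    using subspace_add[OF assms fg(1) fg(3)] by (intro exI[of _ "\<lambda>n. f n + g n"]) auto
next
  fix a :: real and x assume "x \<in> closure C"
  then obtain f where fg: "\<And>n. f n \<in> C" "f \<longlonglongrightarrow> x"
    unfolding closure_sequential by blast
  have "(\<lambda>n. a *\<^sub>R f n) \<longlonglongrightarrow> a *\<^sub>R x" by (intro tendsto_intros fg)
  then show "a *\<^sub>R x \<in> closure C"
    unfolding closure_sequential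
    using subspace_scale[OF assms fg(1)] by (intro exI[of _ "\<lambda>n. a *\<^sub>R f n"]) auto
qed

lemma subspace_dense_if_trivial_orthogonal_complement:
  fixes C :: "'a::{real_inner, banach} set"
  assumes "subspace C" "\<And>x. (\<And>y. y \<in> C \<Longrightarrow> inner x y = 0) \<Longrightarrow> x = 0"
  shows "closure C = UNIV"
proof -
  have "x \<in> closure C" for x
  proof -
    obtain c where c: "c \<in> closure C" "\<And>y. y \<in> closure C \<Longrightarrow> inner (x - c) y = 0"
      using orthogonal_projection_exists[OF subspace_closure[OF assms(1)] closed_closure] by blast
    have "x - c = 0"
      using assms(2) c(2) closure_subset by blast
    then show ?thesis using c(1) by simp
  qed
  then show ?thesis by blast
qed

section \<open>The adjoint of a generator is densely defined\<close>

text \<open>The closed sets \<open>{h. norm (S t h) \<le> k + 1 for all t \<in> [0, 1 / (k + 1)]}\<close> exhaust the space, because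
  \<open>S t h \<longrightarrow> h\<close> as \<open>t \<longrightarrow> 0\<close> for every \<open>h\<close>. By Baire's theorem one of them contains a ball.\<close>

lemma C0_semigroup_locally_bounded:
  fixes S :: "real \<Rightarrow> 'h::banach \<Rightarrow> 'h"
  assumes S: "C0_semigroup S"
  obtains B \<delta> where "0 < \<delta>" "0 \<le> B" "\<And>t h. 0 \<le> t \<Longrightarrow> t \<le> \<delta> \<Longrightarrow> norm (S t h) \<le> B * norm h"
proof -
  have lin: "bounded_linear (S t)" if "0 \<le> t" for t
    using S that by (simp add: C0_semigroup_def)
  define E where
    "E k = {h. \<forall>t\<in>{0..inverse (real (Suc k))}. norm (S t h) \<le> real (Suc k)}" for k
  have closed_E: "closed (E k)" for k
  proof -
    have "E k = (\<Inter>t\<in>{0..inverse (real (Suc k))}. {h. norm (S t h) \<le> real (Suc k)})"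
      by (auto simp: E_def)
    also have "closed \<dots>"
    proof (intro closed_INT ballI closed_Collect_le continuous_intros)
      fix t assume "t \<in> {0..inverse (real (Suc k))}"
      then show "continuous_on UNIV (S t)"
        using lin[of t] by (simp add: linear_continuous_on)
    qed
    finally show ?thesis .
  qed
  have "\<exists>k. h \<in> E k" for h
  proof -
    have "((\<lambda>t. S t h) \<longlongrightarrow> h) (at_right 0)" "S 0 h = h"
      using S by (auto simp: C0_semigroup_def)
    then have "\<forall>\<^sub>F t in at_right 0. dist (S t h) h < 1"
      by (auto simp: tendsto_iff)
    then obtain b where b: "0 < b" "\<And>t. 0 < t \<Longrightarrow> t < b \<Longrightarrow> dist (S t h) h < 1"
      by (auto simp: eventually_at_right_field)
    have near: "norm (S t h) \<le> norm h + 1" if "0 \<le> t" "t < b" for t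
    proof (cases "t = 0")
      case False
      then have "dist (S t h) h < 1" using b(2)[of t] that by simp
      then show ?thesis using norm_triangle_sub[of "S t h" h] by (simp add: dist_norm)
    qed (simp add: \<open>S 0 h = h\<close>)
    obtain k1 where k1: "inverse (real (Suc k1)) < b"
      using reals_Archimedean[OF b(1)] by auto
    obtain k2 where k2: "norm h + 1 \<le> real k2"
      using real_arch_simple by blast
    define k where "k = max k1 k2"
    have "inverse (real (Suc k)) \<le> inverse (real (Suc k1))"
      by (simp add: k_def field_simps)
    then have "inverse (real (Suc k)) < b" using k1 by linarith
    moreover have "norm h + 1 \<le> real (Suc k)"
      using k2 by (simp add: k_def)
    ultimately have "h \<in> E k"
      using near by (fastforce simp: E_def)
    then show ?thesis ..
  qed
  then have union: "\<Union>(range E) = UNIV" by auto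
  have "\<exists>k. interior (E k) \<noteq> {}"
  proof (rule ccontr)
    assume "\<not> ?thesis"
    then have "Met_TC.mtopology interior_of \<Union>(range E) = {}"
      by (intro Met_TC.metric_Baire_category_alt)
         (auto simp: closed_E complete_UNIV)
    then show False by (simp add: union)
  qed
  then obtain k x where "x \<in> interior (E k)" by blast
  then obtain r where r: "0 < r" "cball x r \<subseteq> E k"
    by (metis interior_subset open_contains_cball open_interior subset_trans)
  let ?K = "real (Suc k)"
  show ?thesis
  proof (rule that[of "inverse ?K" "2 * ?K / r"])
    fix t h assume t: "0 \<le> t" "t \<le> inverse ?K"
    interpret bounded_linear "S t" by (rule lin) fact
    show "norm (S t h) \<le> (2 * ?K / r) * norm h"
    proof (cases "h = 0")
      case False
      \<comment> \<open>\<open>y\<close> is \<open>h\<close> rescaled to norm \<open>r\<close>, a difference of two points of the ball\<close>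
      define y where "y = (r / norm h) *\<^sub>R h"
      have "x + y \<in> cball x r" "x \<in> cball x r"
        using False r(1) by (auto simp: y_def dist_norm)
      then have "norm (S t (x + y)) \<le> ?K" "norm (S t x) \<le> ?K"
        using r(2) t by (auto simp: E_def subset_iff)
      then have "norm (S t y) \<le> 2 * ?K"
        using norm_triangle_ineq4[of "S t (x + y)" "S t x"] by (simp add: add)
      moreover have "norm (S t y) = r / norm h * norm (S t h)"
        using r(1) by (simp add: y_def scaleR)
      ultimately show ?thesis
        using r(1) False by (simp add: field_simps)
    qed (simp add: zero)
  qed (use r(1) in auto)
qed

text \<open>The proof writes \<open>S t h - h\<close> as the telescoping sum of
  \<open>S (i t / N) (S (t / N) h - h)\<close> over \<open>i < N\<close> and lets \<open>N\<close> tend to infinity. In this way neither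
  vector-valued integrals nor derivatives away from 0 are needed.\<close>

lemma C0_semigroup_increment_bound:
  fixes S :: "real \<Rightarrow> 'h::banach \<Rightarrow> 'h"
  assumes S: "C0_semigroup S"
    and B: "\<And>u h. 0 \<le> u \<Longrightarrow> u \<le> t \<Longrightarrow> norm (S u h) \<le> B * norm h"
    and t: "0 < t"
    and l: "((\<lambda>t. (S t h - h) /\<^sub>R t) \<longlongrightarrow> l) (at_right 0)"
    and K: "\<And>u. 0 \<le> u \<Longrightarrow> u \<le> t \<Longrightarrow> norm (S u g - g) \<le> K"
  shows "norm (S t h - h - t *\<^sub>R g) \<le> t * (B * norm (l - g) + K)"
proof -
  have lin: "bounded_linear (S t)" if "0 \<le> t" for t
    using S that by (simp add: C0_semigroup_def)
  have S0: "S 0 h = h" using S by (simp add: C0_semigroup_def)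
  have Sadd: "S (a + b) h = S a (S b h)" if "0 \<le> a" "0 \<le> b" for a b
    using S that by (simp add: C0_semigroup_def)
  define q where "q N = t / real (Suc N)" for N
  define D where "D N = (S (q N) h - h) /\<^sub>R q N" for N
  have q0: "0 < q N" for N using t by (simp add: q_def)
  have bound: "norm (S t h - h - t *\<^sub>R g) \<le> t * (B * norm (D N - g) + K)" for N
  proof -
    let ?s = "\<lambda>i. real i * q N"
    have sN: "?s (Suc N) = t" by (simp add: q_def)
    have s: "0 \<le> ?s i" "?s i \<le> t" if "i < Suc N" for i
    proof -
      show "0 \<le> ?s i" using q0[of N] by simp
      have "?s i \<le> ?s (Suc N)" using that q0[of N] by (intro mult_right_mono) auto
      then show "?s i \<le> t" using sN by simp
    qed
    have "S t h - h = (\<Sum>i<Suc N. S (?s (Suc i)) h - S (?s i) h)"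
      by (subst sum_lessThan_telescope) (simp add: sN S0 del: of_nat_Suc)
    also have "\<dots> = (\<Sum>i<Suc N. q N *\<^sub>R S (?s i) (D N))"
    proof (rule sum.cong[OF refl])
      fix i
      interpret bounded_linear "S (?s i)" using lin q0[of N] by simp
      have "S (?s (Suc i)) h = S (?s i) (S (q N) h)"
        using Sadd[of "?s i" "q N"] q0[of N] by (simp add: algebra_simps)
      then show "S (?s (Suc i)) h - S (?s i) h = q N *\<^sub>R S (?s i) (D N)"
        using q0[of N] by (simp add: D_def scaleR diff)
    qed
    finally have "S t h - h - t *\<^sub>R g = (\<Sum>i<Suc N. q N *\<^sub>R (S (?s i) (D N) - g))"
      by (simp add: scaleR_diff_right sum_subtractf sum_constant_scaleR flip: sN del: sum.lessThan_Suc)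
    also have "norm \<dots> \<le> (\<Sum>i<Suc N. q N * (B * norm (D N - g) + K))"
    proof (rule sum_norm_le)
      fix i assume "i \<in> {..<Suc N}"
      then have i: "0 \<le> ?s i" "?s i \<le> t" using s[of i] by auto
      interpret bounded_linear "S (?s i)" using lin i by simp
      have "norm (S (?s i) (D N) - g) \<le> norm (S (?s i) (D N - g)) + norm (S (?s i) g - g)"
        using norm_triangle_ineq[of "S (?s i) (D N - g)" "S (?s i) g - g"] by (simp add: diff)
      also have "\<dots> \<le> B * norm (D N - g) + K"
        by (intro add_mono B K i)
      finally show "norm (q N *\<^sub>R (S (?s i) (D N) - g)) \<le> q N * (B * norm (D N - g) + K)"
        using q0[of N] by (simp add: mult_left_mono)
    qed
    also have "\<dots> = t * (B * norm (D N - g) + K)"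
      by (simp flip: sN del: of_nat_Suc)
    finally show ?thesis .
  qed
  have "filterlim q (at_right 0) sequentially"
  proof -
    have "(\<lambda>N. t * inverse (real (Suc N))) \<longlonglongrightarrow> t * 0"
      by (intro tendsto_intros LIMSEQ_inverse_real_of_nat)
    then have "q \<longlonglongrightarrow> 0" by (simp add: q_def[abs_def] divide_inverse)
    then show ?thesis using q0 by (auto simp: filterlim_at less_imp_neq[symmetric])
  qed
  then have "D \<longlonglongrightarrow> l"
    unfolding D_def[abs_def] by (rule filterlim_compose[OF l])
  then have "(\<lambda>N. t * (B * norm (D N - g) + K)) \<longlonglongrightarrow> t * (B * norm (l - g) + K)"
    by (intro tendsto_intros)
  then show ?thesis
    by (rule LIMSEQ_le_const) (use bound in blast)
qed

text \<open>If \<open>h n \<longrightarrow> 0\<close> and \<open>A (h n) \<longrightarrow> x\<close>, the increment bound with \<open>g = x\<close> becomes, in the limit of large \<open>n\<close>,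
  \<open>norm x \<le> sup {norm (S u x - x) | 0 \<le> u \<le> t}\<close>, and the right-hand side vanishes as \<open>t \<longrightarrow> 0\<close>.\<close>

lemma C0_generator_closable:
  fixes A :: "'h::banach \<Rightarrow> 'h"
  assumes gen: "C0_generator D A" and x: "(0, x) \<in> closure {(h, A h) |h. h \<in> D}"
  shows "x = 0"
proof -
  obtain S where S: "C0_semigroup S"
    and deriv: "\<And>h. h \<in> D \<Longrightarrow> ((\<lambda>t. (S t h - h) /\<^sub>R t) \<longlongrightarrow> A h) (at_right 0)"
    using gen by (auto simp: C0_generator_def)
  obtain B \<delta> where B: "0 < \<delta>" "0 \<le> B" "\<And>t h. 0 \<le> t \<Longrightarrow> t \<le> \<delta> \<Longrightarrow> norm (S t h) \<le> B * norm h"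
    by (rule C0_semigroup_locally_bounded[OF S]) (rule that)
  obtain z where z: "\<And>n. z n \<in> {(h, A h) |h. h \<in> D}" "z \<longlonglongrightarrow> (0, x)"
    using x unfolding closure_sequential by blast
  define h where "h n = fst (z n)" for n
  have hD: "h n \<in> D" and Ah: "A (h n) = snd (z n)" for n
    using z(1)[of n] by (auto simp: h_def)
  have h0: "h \<longlonglongrightarrow> 0" using tendsto_fst[OF z(2)] by (simp add: h_def[abs_def])
  have Ax: "(\<lambda>n. A (h n)) \<longlonglongrightarrow> x" using tendsto_snd[OF z(2)] by (simp add: Ah)
  have "norm x \<le> e" if e: "0 < e" for e
  proof -
    have "((\<lambda>t. S t x) \<longlongrightarrow> x) (at_right 0)" "S 0 x = x"
      using S by (auto simp: C0_semigroup_def)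
    then have "\<forall>\<^sub>F t in at_right 0. dist (S t x) x < e"
      using e by (auto simp: tendsto_iff)
    then obtain b where b: "0 < b" "\<And>t. 0 < t \<Longrightarrow> t < b \<Longrightarrow> dist (S t x) x < e"
      by (auto simp: eventually_at_right_field)
    \<comment> \<open>the semigroup is bounded by \<open>B\<close> on \<open>[0, t]\<close> and moves \<open>x\<close> by at most \<open>e\<close> there\<close>
    define t where "t = min \<delta> (b / 2)"
    have t: "0 < t" "t \<le> \<delta>" "t < b" using b(1) B(1) by (auto simp: t_def)
    have near: "norm (S u x - x) \<le> e" if "0 \<le> u" "u \<le> t" for u
      using b(2)[of u] that t e \<open>S 0 x = x\<close> by (cases "u = 0") (auto simp: dist_norm)
    have "norm (S t (h n) - h n - t *\<^sub>R x) \<le> t * (B * norm (A (h n) - x) + e)" for n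
      by (rule C0_semigroup_increment_bound[OF S _ t(1) deriv[OF hD]])
         (use B(3) t near in auto)
    moreover have "(\<lambda>n. norm (S t (h n) - h n - t *\<^sub>R x)) \<longlonglongrightarrow> norm (S t 0 - 0 - t *\<^sub>R x)"
      by (intro tendsto_intros h0 bounded_linear.tendsto[where f = "S t"])
         (use S t in \<open>auto simp: C0_semigroup_def\<close>)
    moreover have "(\<lambda>n. t * (B * norm (A (h n) - x) + e)) \<longlonglongrightarrow> t * (B * norm (x - x) + e)"
      by (intro tendsto_intros Ax)
    ultimately have "norm (S t 0 - 0 - t *\<^sub>R x) \<le> t * (B * norm (x - x) + e)"
      by (intro LIMSEQ_le[of "\<lambda>n. norm (S t (h n) - h n - t *\<^sub>R x)"]) auto
    moreover have "S t 0 = 0"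
      using S t by (auto simp: C0_semigroup_def intro!: linear_0 bounded_linear.linear)
    ultimately show ?thesis using t(1) by simp
  qed
  then show "x = 0"
    using field_le_epsilon[of "norm x" 0] by simp
qed

lemma subspace_graph_C0_generator:
  fixes A :: "'h::real_normed_vector \<Rightarrow> 'h"
  assumes gen: "C0_generator D A"
  shows "subspace {(h, A h) |h. h \<in> D}"
proof -
  obtain S where S: "C0_semigroup S"
    and D: "D = {h. \<exists>l. ((\<lambda>t. (S t h - h) /\<^sub>R t) \<longlongrightarrow> l) (at_right 0)}"
    and deriv: "\<And>h. h \<in> D \<Longrightarrow> ((\<lambda>t. (S t h - h) /\<^sub>R t) \<longlongrightarrow> A h) (at_right 0)"
    using gen by (auto simp: C0_generator_def)
  have mem: "h \<in> D \<and> A h = l" if "((\<lambda>t. (S t h - h) /\<^sub>R t) \<longlongrightarrow> l) (at_right 0)" for h l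
    using that deriv tendsto_unique[OF trivial_limit_at_right_real] unfolding D by blast
  have ev: "\<forall>\<^sub>F t in at_right 0. bounded_linear (S t)"
    using S by (auto simp: C0_semigroup_def eventually_at_right_field intro!: exI[of _ 1])
  have add: "h + k \<in> D \<and> A (h + k) = A h + A k" if "h \<in> D" "k \<in> D" for h k
  proof (rule mem)
    have "((\<lambda>t. (S t h - h) /\<^sub>R t + (S t k - k) /\<^sub>R t) \<longlongrightarrow> A h + A k) (at_right 0)"
      by (intro tendsto_add deriv that)
    then show "((\<lambda>t. (S t (h + k) - (h + k)) /\<^sub>R t) \<longlongrightarrow> A h + A k) (at_right 0)"
      by (rule Lim_transform_eventually)
         (use ev in eventually_elim, simp add: bounded_linear.linear linear_add algebra_simps)
  qed
  have scale: "c *\<^sub>R h \<in> D \<and> A (c *\<^sub>R h) = c *\<^sub>R A h" if "h \<in> D" for c h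
  proof (rule mem)
    have "((\<lambda>t. c *\<^sub>R ((S t h - h) /\<^sub>R t)) \<longlongrightarrow> c *\<^sub>R A h) (at_right 0)"
      by (intro tendsto_intros deriv that)
    then show "((\<lambda>t. (S t (c *\<^sub>R h) - c *\<^sub>R h) /\<^sub>R t) \<longlongrightarrow> c *\<^sub>R A h) (at_right 0)"
      by (rule Lim_transform_eventually)
         (use ev in eventually_elim, simp add: bounded_linear.linear linear_scale algebra_simps)
  qed
  have zero: "0 \<in> D \<and> A 0 = 0"
  proof (rule mem)
    show "((\<lambda>t. (S t 0 - 0) /\<^sub>R t) \<longlongrightarrow> 0) (at_right 0)"
      by (rule tendsto_eventually)
         (use ev in eventually_elim, simp add: bounded_linear.linear linear_0)
  qed
  show ?thesis
    unfolding subspace_def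
    by (safe; use add scale zero in \<open>force simp: zero_prod_def\<close>)
qed

lemma subspace_adjoint_domain: "subspace (adjoint_domain D A)"
  unfolding subspace_def
proof (intro conjI ballI allI)
  show "0 \<in> adjoint_domain D A" by (auto simp: adjoint_domain_def intro!: exI[of _ 0])
  fix x y assume "x \<in> adjoint_domain D A" "y \<in> adjoint_domain D A"
  then obtain a b where "\<forall>h\<in>D. inner (A h) x = inner h a" "\<forall>h\<in>D. inner (A h) y = inner h b"
    by (auto simp: adjoint_domain_def)
  then show "x + y \<in> adjoint_domain D A"
    by (auto simp: adjoint_domain_def inner_simps intro!: exI[of _ "a + b"])
next
  fix c :: real and x assume "x \<in> adjoint_domain D A"
  then obtain a where "\<forall>h\<in>D. inner (A h) x = inner h a"
    by (auto simp: adjoint_domain_def)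
  then show "c *\<^sub>R x \<in> adjoint_domain D A"
    by (auto simp: adjoint_domain_def inner_simps intro!: exI[of _ "c *\<^sub>R a"])
qed

text \<open>Von Neumann's argument: let \<open>x\<close> be orthogonal to the domain of the adjoint, and let \<open>(u, v)\<close> be the
  difference of \<open>(0, x)\<close> and its projection onto the closure of the graph of \<open>A\<close>. Orthogonality of
  \<open>(u, v)\<close> to the graph says that \<open>v\<close> is in the domain of the adjoint, so that \<open>v\<close> is orthogonal to \<open>x\<close>.
  This forces \<open>(0, x)\<close> into the closure of the graph, whence \<open>x = 0\<close>.\<close>

lemma C0_generator_adjoint_domain_dense:
  fixes A :: "'h::{real_inner, banach} \<Rightarrow> 'h"
  assumes gen: "C0_generator D A"
  shows "closure (adjoint_domain D A) = UNIV"
proof (rule subspace_dense_if_trivial_orthogonal_complement[OF subspace_adjoint_domain])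
  fix x assume x: "\<And>y. y \<in> adjoint_domain D A \<Longrightarrow> inner x y = 0"
  let ?G = "{(h, A h) |h. h \<in> D}"
  obtain c where c: "c \<in> closure ?G" "\<And>y. y \<in> closure ?G \<Longrightarrow> inner ((0, x) - c) y = 0"
    by (rule orthogonal_projection_exists[OF subspace_closure[OF subspace_graph_C0_generator[OF gen]]
          closed_closure, where x = "(0, x)"]) (rule that)
  obtain u v :: 'h where uv: "(0, x) - c = (u, v)" by (cases "(0, x) - c") (rule that)
  have "inner (A h) v = inner h (- u)" if "h \<in> D" for h
  proof -
    have "(h, A h) \<in> closure ?G"
      by (rule closure_subset[THEN subsetD]) (use that in blast)
    then have "inner (u, v) (h, A h) = 0" using c(2)[of "(h, A h)"] by (simp add: uv)
    then show ?thesis by (simp add: inner_commute)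
  qed
  then have "v \<in> adjoint_domain D A" unfolding adjoint_domain_def by blast
  then have "inner x v = 0" by (rule x)
  \<comment> \<open>hence the residual is orthogonal both to its projection and to \<open>(0, x)\<close>\<close>
  then have "inner ((0, x) - c) (0, x) = 0" by (simp add: uv inner_commute)
  moreover have "inner ((0, x) - c) c = 0" using c by blast
  ultimately have "inner ((0, x) - c) ((0, x) - c) = 0" by (simp only: inner_diff_right)
  then have "(0, x) = c" by simp
  then show "x = 0" using C0_generator_closable[OF gen] c(1) by simp
qed

section \<open>Orthonormal bases and Hilbert--Schmidt norms\<close>

lemma orthonormal_basis_exists:
  "\<exists>B :: 'a::{real_inner, banach} set. orthonormal_basis B"
proof -
  let ?A = "{B :: 'a set. (\<forall>u\<in>B. norm u = 1) \<and> pairwise orthogonal B}"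
  have "\<exists>B\<in>?A. \<forall>X\<in>?A. B \<subseteq> X \<longrightarrow> X = B"
  proof (rule subset_Zorn')
    fix \<C> assume \<C>: "subset.chain ?A \<C>"
    have "pairwise orthogonal (\<Union>\<C>)"
    proof (rule pairwiseI)
      fix u v assume uv: "u \<in> \<Union>\<C>" "v \<in> \<Union>\<C>" "u \<noteq> v"
      then obtain X Y where XY: "X \<in> \<C>" "Y \<in> \<C>" "u \<in> X" "v \<in> Y" by auto
      have "X \<subseteq> Y \<or> Y \<subseteq> X" using \<C> XY(1,2) unfolding subset.chain_def by blast
      moreover have "pairwise orthogonal X" "pairwise orthogonal Y"
        using \<C> XY by (auto simp: subset.chain_def)
      ultimately show "orthogonal u v" using XY uv(3) by (meson pairwiseD subsetD)
    qed
    moreover have "\<forall>u\<in>\<Union>\<C>. norm u = 1" using \<C> by (auto simp: subset.chain_def)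
    ultimately show "\<Union>\<C> \<in> ?A" by simp
  qed
  then obtain B where "B \<in> ?A" and maximal: "\<And>X. X \<in> ?A \<Longrightarrow> B \<subseteq> X \<Longrightarrow> X = B"
    by (elim bexE) (rule that, assumption, simp only: Ball_def)
  then have B: "\<And>u. u \<in> B \<Longrightarrow> norm u = 1" "pairwise orthogonal B" by simp_all
  have "closure (span B) = UNIV"
  proof (rule subspace_dense_if_trivial_orthogonal_complement[OF subspace_span])
    fix x assume x: "\<And>y. y \<in> span B \<Longrightarrow> inner x y = 0"
    show "x = 0"
    proof (rule ccontr)
      assume "x \<noteq> 0"
      define v where "v = x /\<^sub>R norm x"
      have v: "norm v = 1" using \<open>x \<noteq> 0\<close> by (simp add: v_def)
      have "orthogonal v y" if "y \<in> B" for y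
        using x[OF span_base[OF that]] by (simp add: orthogonal_def v_def)
      then have "pairwise orthogonal (insert v B)"
        using B(2) by (simp add: pairwise_insert orthogonal_commute)
      then have "insert v B \<in> ?A" using B(1) v by simp
      then have "v \<in> B" using maximal[of "insert v B"] by blast
      then have "inner x v = 0" using x span_base by blast
      then show False using \<open>x \<noteq> 0\<close> by (simp add: v_def)
    qed
  qed
  then show ?thesis using B by (auto simp: orthonormal_basis_def)
qed

lemma countable_orthonormal_basis:
  fixes B :: "'a::{real_inner, second_countable_topology} set"
  assumes "orthonormal_basis B"
  shows "countable B"
proof -
  have B: "\<And>u. u \<in> B \<Longrightarrow> norm u = 1" "pairwise orthogonal B"
    using assms by (auto simp: orthonormal_basis_def)
  have far: "1 < dist u v" if "u \<in> B" "v \<in> B" "u \<noteq> v" for u v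
  proof (rule power_less_imp_less_base[where n = 2])
    have "orthogonal u v" using B(2) that by (simp add: pairwise_def)
    then have "inner u v = 0" "inner v u = 0" by (auto simp: orthogonal_def inner_commute)
    then have "(dist u v)\<^sup>2 = (norm u)\<^sup>2 + (norm v)\<^sup>2"
      unfolding dist_norm power2_norm_eq_inner by (simp add: inner_simps)
    then show "1\<^sup>2 < (dist u v)\<^sup>2" using B(1) that by simp
  qed simp
  have disj: "disjnt (ball u (1/2)) (ball v (1/2))" if "u \<in> B" "v \<in> B" "u \<noteq> v" for u v
    unfolding disjnt_def using far[OF that] by (intro disjoint_ballI) simp
  have "countable ((\<lambda>u. ball u (1/2)) ` B)"
    by (rule countable_disjoint_open_subsets) (use disj in \<open>auto simp: pairwise_def\<close>)
  moreover have "inj_on (\<lambda>u. ball u (1/2)) B"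
  proof (rule inj_onI, rule ccontr)
    fix u v assume uv: "u \<in> B" "v \<in> B" "ball u (1/2) = ball v (1/2 :: real)" "u \<noteq> v"
    then have "ball u (1/2) = {}" using disj[of u v] by (simp add: disjnt_def)
    then show False by simp
  qed
  ultimately show ?thesis using countable_image_inj_on by blast
qed

text \<open>Countability turns the Hilbert--Schmidt norm into a countable sum, which depends measurably on
  parameters. Measurability is indispensable below: the integral of nonnegative functions is in general
  subadditive only for measurable functions.\<close>

lemma countable_some_orthonormal_basis:
  "countable (some_orthonormal_basis :: 'a::{real_inner, banach, second_countable_topology} set)"
  unfolding some_orthonormal_basis_def
  by (rule countable_orthonormal_basis) (rule someI_ex[OF orthonormal_basis_exists])

lemma norm_add_sq_le: "ennreal ((norm (x + y))\<^sup>2) \<le> 2 * (ennreal ((norm x)\<^sup>2) + ennreal ((norm y)\<^sup>2))"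
proof -
  have "(norm (x + y))\<^sup>2 \<le> (norm x + norm y)\<^sup>2"
    by (intro power_mono norm_triangle_ineq) simp
  also have "\<dots> \<le> 2 * ((norm x)\<^sup>2 + (norm y)\<^sup>2)"
    using sum_squares_bound[of "norm x" "norm y"] by (simp add: power2_sum)
  finally have "ennreal ((norm (x + y))\<^sup>2) \<le> ennreal (2 * ((norm x)\<^sup>2 + (norm y)\<^sup>2))"
    by (rule ennreal_leI)
  then show ?thesis by (simp add: ennreal_mult ennreal_plus)
qed

lemma norm_blinfun_sq_le:
  "ennreal ((norm (blinfun_apply T x))\<^sup>2) \<le> ennreal ((norm T)\<^sup>2) * ennreal ((norm x)\<^sup>2)"
proof -
  have "(norm (blinfun_apply T x))\<^sup>2 \<le> (norm T * norm x)\<^sup>2"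
    by (intro power_mono norm_blinfun) simp
  then show ?thesis
    by (simp add: power_mult_distrib ennreal_leI flip: ennreal_mult)
qed

lemma hs_norm_sq_blinfun_image_le:
  "hs_norm_sq Q (\<lambda>u. blinfun_apply T (L u)) \<le> ennreal ((norm T)\<^sup>2) * hs_norm_sq Q L"
  unfolding hs_norm_sq_def
  by (subst nn_integral_cmult[symmetric]) (auto intro!: nn_integral_mono norm_blinfun_sq_le)

lemma hs_norm_sq_add_le:
  "hs_norm_sq Q (\<lambda>u. L u + K u) \<le> 2 * (hs_norm_sq Q L + hs_norm_sq Q K)"
  unfolding hs_norm_sq_def
  by (subst nn_integral_add[symmetric]; (subst nn_integral_cmult[symmetric])?)
     (simp_all add: nn_integral_mono norm_add_sq_le del: distrib_left_numeral)

lemma borel_measurable_hs_norm_sq: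
  fixes L :: "'s \<Rightarrow> 'u::{real_inner, banach, second_countable_topology} \<Rightarrow> 'h::real_normed_vector"
  assumes "\<And>u. (\<lambda>s. L s (operator_sqrt Q u)) \<in> borel_measurable N"
  shows "(\<lambda>s. hs_norm_sq Q (L s)) \<in> borel_measurable N"
proof -
  let ?B = "some_orthonormal_basis :: 'u set"
  interpret sigma_finite_measure "count_space ?B"
    by (rule sigma_finite_measure_count_space_countable[OF countable_some_orthonormal_basis])
  have "(\<lambda>(u, s). ennreal ((norm (L s (operator_sqrt Q u)))\<^sup>2)) \<in> borel_measurable (count_space ?B \<Otimes>\<^sub>M N)"
    by (rule measurable_pair_measure_countable1[OF countable_some_orthonormal_basis])
       (use assms in simp)
  then have "(\<lambda>(s, u). ennreal ((norm (L s (operator_sqrt Q u)))\<^sup>2)) \<in> borel_measurable (N \<Otimes>\<^sub>M count_space ?B)"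
    by (subst measurable_pair_swap_iff) (simp add: case_prod_beta')
  then show ?thesis
    unfolding hs_norm_sq_def by (rule borel_measurable_nn_integral)
qed

section \<open>Sections of processes and square norms of integrands\<close>

lemma usual_conditions_space:
  assumes "usual_conditions M F" "0 \<le> t"
  shows "space (F t) = space M"
  using assms by (auto simp: usual_conditions_def subalgebra_def)

lemma progressive_section_measurable:
  assumes "usual_conditions M F" "progressive F X" "\<omega> \<in> space M" "0 \<le> T"
  shows "(\<lambda>s. X s \<omega>) \<in> borel_measurable (restrict_space lborel {0..T})"
proof -
  have "(\<lambda>s. (s, \<omega>)) \<in> measurable (restrict_space borel {0..T}) (restrict_space borel {0..T} \<Otimes>\<^sub>M F T)"
    using usual_conditions_space[OF assms(1,4)] assms(3) by (intro measurable_Pair2') simp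
  from measurable_compose[OF this, of "\<lambda>(s, \<omega>). X s \<omega>" borel] assms(2,4)
  have "(\<lambda>s. X s \<omega>) \<in> borel_measurable (restrict_space borel {0..T})"
    by (simp add: progressive_def)
  also have "borel_measurable (restrict_space borel {0..T}) = borel_measurable (restrict_space lborel {0..T})"
    by (intro measurable_cong_sets sets_restrict_space_cong) simp_all
  finally show ?thesis .
qed

lemma nn_integral_interval:
  "(\<integral>\<^sup>+ s\<in>{0..T}. f s \<partial>lborel) = nn_integral (restrict_space lborel {0..T::real}) f"
  by (simp add: nn_integral_restrict_space)

lemma wiener_integrand_section_measurable:
  assumes "usual_conditions M F" "wiener_integrand M F Q \<Phi>" "\<omega> \<in> space M" "0 \<le> T"
  shows "(\<lambda>s. \<Phi> s \<omega> (operator_sqrt Q u)) \<in> borel_measurable (restrict_space lborel {0..T})"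
  by (rule progressive_section_measurable[OF assms(1) _ assms(3,4)])
     (use assms(2) in \<open>simp add: wiener_integrand_def\<close>)

lemma elementary_wiener_fun_measurable:
  fixes \<phi> :: "('w, 'u::real_normed_vector, 'h::{real_normed_vector, second_countable_topology}) elementary_wiener"
  shows "(\<lambda>s. elementary_wiener_fun \<phi> s \<omega> u) \<in> borel_measurable (restrict_space lborel A)"
proof (induction \<phi>)
  case (Cons x \<phi>)
  obtain a b B L where x: "x = (a, b, B, L)" by (cases x)
  have "(\<lambda>s. (indicator B \<omega> * indicator {a<..b} s :: real) *\<^sub>R blinfun_apply L u)
      \<in> borel_measurable (restrict_space lborel A)"
    by (rule measurable_restrict_space1) simp
  from borel_measurable_add[OF this Cons.IH] show ?case
    by (simp add: x elementary_wiener_fun_def)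
qed (simp add: elementary_wiener_fun_def)

lemma wiener_error_measurable:
  fixes \<Phi> :: "real \<Rightarrow> 'w \<Rightarrow> 'u::{real_inner, banach, second_countable_topology}
      \<Rightarrow> 'h::{real_normed_vector, second_countable_topology}"
  assumes "usual_conditions M F" "wiener_integrand M F Q \<Phi>" "\<omega> \<in> space M" "0 \<le> T"
  shows "(\<lambda>s. hs_norm_sq Q (\<lambda>u. elementary_wiener_fun \<phi> s \<omega> u - \<Phi> s \<omega> u))
    \<in> borel_measurable (restrict_space lborel {0..T})"
  by (intro borel_measurable_hs_norm_sq borel_measurable_diff elementary_wiener_fun_measurable
      wiener_integrand_section_measurable[OF assms])

lemma wiener_integrand_norm_measurable:
  fixes \<Phi> :: "real \<Rightarrow> 'w \<Rightarrow> 'u::{real_inner, banach, second_countable_topology}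
      \<Rightarrow> 'h::{real_normed_vector, second_countable_topology}"
  assumes "usual_conditions M F" "wiener_integrand M F Q \<Phi>" "\<omega> \<in> space M" "0 \<le> T"
  shows "(\<lambda>s. hs_norm_sq Q (\<Phi> s \<omega>)) \<in> borel_measurable (restrict_space lborel {0..T})"
  by (intro borel_measurable_hs_norm_sq wiener_integrand_section_measurable[OF assms])

lemma tendsto_0_le_cmult:
  fixes I J :: "nat \<Rightarrow> ennreal"
  assumes "\<And>n. I n \<le> c * J n" "c < top" "J \<longlonglongrightarrow> 0"
  shows "I \<longlonglongrightarrow> 0"
proof (rule tendsto_sandwich[OF _ _ tendsto_const])
  show "(\<lambda>n. c * J n) \<longlonglongrightarrow> 0"
    using ennreal_tendsto_cmult[OF assms(2,3)] by simp
qed (use assms(1) in auto)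

lemma nn_integral_le_cmult_add:
  assumes "f \<in> borel_measurable N" "g \<in> borel_measurable N"
    "\<And>x. x \<in> space N \<Longrightarrow> h x \<le> c * (f x + g x)"
  shows "nn_integral N h \<le> c * (nn_integral N f + nn_integral N g)"
proof -
  have "nn_integral N h \<le> (\<integral>\<^sup>+x. c * (f x + g x) \<partial>N)"
    by (intro nn_integral_mono assms)
  then show ?thesis
    using assms by (simp add: nn_integral_cmult nn_integral_add)
qed

lemma nn_integral_le_cmult:
  assumes "f \<in> borel_measurable N" "\<And>x. x \<in> space N \<Longrightarrow> h x \<le> c * f x"
  shows "nn_integral N h \<le> c * nn_integral N f"
proof -
  have "nn_integral N h \<le> (\<integral>\<^sup>+x. c * f x \<partial>N)"
    by (intro nn_integral_mono assms)
  then show ?thesis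
    using assms by (simp add: nn_integral_cmult)
qed

lemma blinfun_measurable:
  "X \<in> borel_measurable N \<Longrightarrow> (\<lambda>x. blinfun_apply T (X x)) \<in> borel_measurable N"
  by (rule measurable_compose[OF _ borel_measurable_continuous_onI])
     (auto intro: linear_continuous_on blinfun.bounded_linear_right)

lemma adapted_blinfun_image: "adapted F X \<Longrightarrow> adapted F (\<lambda>t \<omega>. blinfun_apply T (X t \<omega>))"
  by (simp add: adapted_def blinfun_measurable)

lemma adapted_add:
  fixes X Y :: "real \<Rightarrow> 'w \<Rightarrow> 'h::{real_normed_vector, second_countable_topology}"
  shows "adapted F X \<Longrightarrow> adapted F Y \<Longrightarrow> adapted F (\<lambda>t \<omega>. X t \<omega> + Y t \<omega>)"
  by (simp add: adapted_def borel_measurable_add)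

lemma progressive_blinfun_image:
  "progressive F X \<Longrightarrow> progressive F (\<lambda>t \<omega>. blinfun_apply T (X t \<omega>))"
  by (auto simp: progressive_def case_prod_beta' intro!: blinfun_measurable)

lemma progressive_add:
  fixes X Y :: "real \<Rightarrow> 'w \<Rightarrow> 'h::{real_normed_vector, second_countable_topology}"
  shows "progressive F X \<Longrightarrow> progressive F Y \<Longrightarrow> progressive F (\<lambda>t \<omega>. X t \<omega> + Y t \<omega>)"
  by (auto simp: progressive_def case_prod_beta' intro!: borel_measurable_add)

lemma cadlag_blinfun_image: "cadlag x \<Longrightarrow> cadlag (\<lambda>t. blinfun_apply T (x t))"
  unfolding cadlag_def by (blast intro: bounded_linear.tendsto[OF blinfun.bounded_linear_right])

lemma cadlag_add:
  fixes x y :: "real \<Rightarrow> 'h::real_normed_vector"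
  shows "cadlag x \<Longrightarrow> cadlag y \<Longrightarrow> cadlag (\<lambda>t. x t + y t)"
  unfolding cadlag_def by (blast intro: tendsto_add)

section \<open>Linearity of the Wiener integral\<close>

lemma hs_operators_blinfun_image:
  assumes "L \<in> hs_operators Q"
  shows "(\<lambda>u. blinfun_apply T (L u)) \<in> hs_operators Q"
proof -
  have "hs_norm_sq Q (\<lambda>u. blinfun_apply T (L u)) \<le> ennreal ((norm T)\<^sup>2) * hs_norm_sq Q L"
    by (rule hs_norm_sq_blinfun_image_le)
  also have "\<dots> < \<infinity>" using assms by (simp add: hs_operators_def ennreal_mult_less_top)
  finally show ?thesis
    using assms bounded_linear_compose[OF blinfun.bounded_linear_right, of "\<lambda>u. L (operator_sqrt Q u)" T]
    by (simp add: hs_operators_def)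
qed

lemma hs_operators_add:
  assumes "L \<in> hs_operators Q" "K \<in> hs_operators Q"
  shows "(\<lambda>u. L u + K u) \<in> hs_operators Q"
proof -
  have "hs_norm_sq Q (\<lambda>u. L u + K u) \<le> 2 * (hs_norm_sq Q L + hs_norm_sq Q K)"
    by (rule hs_norm_sq_add_le)
  also have "\<dots> < \<infinity>" using assms by (simp add: hs_operators_def ennreal_mult_less_top)
  finally show ?thesis
    using assms by (simp add: hs_operators_def bounded_linear_add)
qed

lemma wiener_integrand_blinfun_image:
  fixes \<Phi> :: "real \<Rightarrow> 'w \<Rightarrow> 'u::{real_inner, banach, second_countable_topology}
      \<Rightarrow> 'h::{real_normed_vector, second_countable_topology}"
  assumes "usual_conditions M F" "wiener_integrand M F Q \<Phi>"
  shows "wiener_integrand M F Q (\<lambda>s \<omega> u. blinfun_apply T (\<Phi> s \<omega> u))"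
proof -
  have "AE \<omega> in M. \<forall>t\<ge>0. (\<integral>\<^sup>+ s\<in>{0..t}. hs_norm_sq Q (\<Phi> s \<omega>) \<partial>lborel) < \<infinity>"
    using assms(2) by (simp add: wiener_integrand_def)
  then have "AE \<omega> in M. \<forall>t\<ge>0.
      (\<integral>\<^sup>+ s\<in>{0..t}. hs_norm_sq Q (\<lambda>u. blinfun_apply T (\<Phi> s \<omega> u)) \<partial>lborel) < \<infinity>"
  proof (rule AE_mp, intro AE_I2 impI allI)
    fix \<omega> and t :: real assume \<omega>: "\<omega> \<in> space M" and t: "0 \<le> t"
      and fin: "\<forall>t\<ge>0. (\<integral>\<^sup>+ s\<in>{0..t}. hs_norm_sq Q (\<Phi> s \<omega>) \<partial>lborel) < \<infinity>"
    have "(\<integral>\<^sup>+ s\<in>{0..t}. hs_norm_sq Q (\<lambda>u. blinfun_apply T (\<Phi> s \<omega> u)) \<partial>lborel)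
        \<le> ennreal ((norm T)\<^sup>2) * (\<integral>\<^sup>+ s\<in>{0..t}. hs_norm_sq Q (\<Phi> s \<omega>) \<partial>lborel)"
      unfolding nn_integral_interval
      by (intro nn_integral_le_cmult wiener_integrand_norm_measurable[OF assms \<omega> t]
          hs_norm_sq_blinfun_image_le)
    also have "\<dots> < \<infinity>" using fin t by (simp add: ennreal_mult_less_top)
    finally show "(\<integral>\<^sup>+ s\<in>{0..t}. hs_norm_sq Q (\<lambda>u. blinfun_apply T (\<Phi> s \<omega> u)) \<partial>lborel) < \<infinity>" .
  qed
  with assms(2) show ?thesis
    by (simp add: wiener_integrand_def hs_operators_blinfun_image progressive_blinfun_image)
qed

lemma wiener_integrand_add:
  fixes \<Phi> \<Psi> :: "real \<Rightarrow> 'w \<Rightarrow> 'u::{real_inner, banach, second_countable_topology}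
      \<Rightarrow> 'h::{real_normed_vector, second_countable_topology}"
  assumes M: "usual_conditions M F"
    and \<Phi>: "wiener_integrand M F Q \<Phi>" and \<Psi>: "wiener_integrand M F Q \<Psi>"
  shows "wiener_integrand M F Q (\<lambda>s \<omega> u. \<Phi> s \<omega> u + \<Psi> s \<omega> u)"
proof -
  have "AE \<omega> in M. \<forall>t\<ge>0. (\<integral>\<^sup>+ s\<in>{0..t}. hs_norm_sq Q (\<Phi> s \<omega>) \<partial>lborel) < \<infinity>"
    "AE \<omega> in M. \<forall>t\<ge>0. (\<integral>\<^sup>+ s\<in>{0..t}. hs_norm_sq Q (\<Psi> s \<omega>) \<partial>lborel) < \<infinity>"
    using \<Phi> \<Psi> by (simp_all add: wiener_integrand_def)
  then have "AE \<omega> in M. \<omega> \<in> space M \<longrightarrow> (\<forall>t\<ge>0.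
      (\<integral>\<^sup>+ s\<in>{0..t}. hs_norm_sq Q (\<lambda>u. \<Phi> s \<omega> u + \<Psi> s \<omega> u) \<partial>lborel) < \<infinity>)"
  proof (eventually_elim, intro impI allI)
    fix \<omega> and t :: real assume \<omega>: "\<omega> \<in> space M" and t: "0 \<le> t"
      and fin: "\<forall>t\<ge>0. (\<integral>\<^sup>+ s\<in>{0..t}. hs_norm_sq Q (\<Phi> s \<omega>) \<partial>lborel) < \<infinity>"
        "\<forall>t\<ge>0. (\<integral>\<^sup>+ s\<in>{0..t}. hs_norm_sq Q (\<Psi> s \<omega>) \<partial>lborel) < \<infinity>"
    have "(\<integral>\<^sup>+ s\<in>{0..t}. hs_norm_sq Q (\<lambda>u. \<Phi> s \<omega> u + \<Psi> s \<omega> u) \<partial>lborel)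
        \<le> 2 * ((\<integral>\<^sup>+ s\<in>{0..t}. hs_norm_sq Q (\<Phi> s \<omega>) \<partial>lborel)
              + (\<integral>\<^sup>+ s\<in>{0..t}. hs_norm_sq Q (\<Psi> s \<omega>) \<partial>lborel))"
      unfolding nn_integral_interval
      by (intro nn_integral_le_cmult_add wiener_integrand_norm_measurable[OF M \<Phi> \<omega> t]
          wiener_integrand_norm_measurable[OF M \<Psi> \<omega> t] hs_norm_sq_add_le)
    also have "\<dots> < \<infinity>" using fin t by (simp add: ennreal_mult_less_top)
    finally show "(\<integral>\<^sup>+ s\<in>{0..t}. hs_norm_sq Q (\<lambda>u. \<Phi> s \<omega> u + \<Psi> s \<omega> u) \<partial>lborel) < \<infinity>" .
  qed
  with \<Phi> \<Psi> show ?thesis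
    by (auto simp: wiener_integrand_def intro: hs_operators_add progressive_add)
qed

text \<open>The composition of an elementary integrand with a bounded linear operator. Sums of elementary
  integrands are concatenations of lists.\<close>

definition elementary_wiener_image ::
    "('h::real_normed_vector \<Rightarrow>\<^sub>L 'k::real_normed_vector) \<Rightarrow>
     ('w, 'u::real_normed_vector, 'h) elementary_wiener \<Rightarrow> ('w, 'u, 'k) elementary_wiener" where
  "elementary_wiener_image T = map (\<lambda>(a, b, A, L). (a, b, A, T o\<^sub>L L))"

lemma elementary_wiener_fun_image:
  "elementary_wiener_fun (elementary_wiener_image T \<phi>) s \<omega> u
     = blinfun_apply T (elementary_wiener_fun \<phi> s \<omega> u)"
  by (induction \<phi>)
     (auto simp: elementary_wiener_fun_def elementary_wiener_image_def blinfun.add_right blinfun.scaleR_right)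

lemma elementary_wiener_integral_image:
  "elementary_wiener_integral W (elementary_wiener_image T \<phi>) t \<omega>
     = blinfun_apply T (elementary_wiener_integral W \<phi> t \<omega>)"
  by (induction \<phi>)
     (auto simp: elementary_wiener_integral_def elementary_wiener_image_def blinfun.add_right blinfun.scaleR_right)

lemma elementary_wiener_fun_append:
  "elementary_wiener_fun (\<phi> @ \<psi>) s \<omega> u
     = elementary_wiener_fun \<phi> s \<omega> u + elementary_wiener_fun \<psi> s \<omega> u"
  by (simp add: elementary_wiener_fun_def)

lemma elementary_wiener_integral_append:
  "elementary_wiener_integral W (\<phi> @ \<psi>) t \<omega>
     = elementary_wiener_integral W \<phi> t \<omega> + elementary_wiener_integral W \<psi> t \<omega>"
  by (simp add: elementary_wiener_integral_def)

lemma wiener_integralE: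
  fixes \<Phi> :: "real \<Rightarrow> 'w \<Rightarrow> 'u::real_inner \<Rightarrow> 'h::real_normed_vector"
  assumes "wiener_integral M F Q W \<Phi> X"
  obtains \<phi> :: "nat \<Rightarrow> ('w, 'u, 'h) elementary_wiener" where
    "wiener_integrand M F Q \<Phi>" "adapted F X"
    "\<And>\<omega>. \<omega> \<in> space M \<Longrightarrow> continuous_on {0..} (\<lambda>t. X t \<omega>)"
    "\<And>n. elementary_wiener F (\<phi> n)"
    "AE \<omega> in M. \<forall>T\<ge>0. (\<lambda>n. \<integral>\<^sup>+ s\<in>{0..T}.
        hs_norm_sq Q (\<lambda>u. elementary_wiener_fun (\<phi> n) s \<omega> u - \<Phi> s \<omega> u) \<partial>lborel) \<longlonglongrightarrow> 0"
    "AE \<omega> in M. \<forall>T\<ge>0. uniform_limit {0..T}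
        (\<lambda>n t. elementary_wiener_integral W (\<phi> n) t \<omega>) (\<lambda>t. X t \<omega>) sequentially"
  using assms unfolding wiener_integral_def
  by (elim conjE exE) (rule that; (assumption | erule (1) bspec | erule spec))

lemma wiener_integral_blinfun_image:
  fixes \<Phi> :: "real \<Rightarrow> 'w \<Rightarrow> 'u::{real_inner, banach, second_countable_topology}
      \<Rightarrow> 'h::{real_normed_vector, second_countable_topology}"
  assumes M: "usual_conditions M F" and X: "wiener_integral M F Q W \<Phi> X"
  shows "wiener_integral M F Q W (\<lambda>s \<omega> u. blinfun_apply T (\<Phi> s \<omega> u))
    (\<lambda>t \<omega>. blinfun_apply T (X t \<omega>))"
proof -
  obtain \<phi> :: "nat \<Rightarrow> ('w, 'u, 'h) elementary_wiener" where
    \<Phi>: "wiener_integrand M F Q \<Phi>" and "adapted F X"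
    and cont: "\<And>\<omega>. \<omega> \<in> space M \<Longrightarrow> continuous_on {0..} (\<lambda>t. X t \<omega>)"
    and \<phi>: "\<And>n. elementary_wiener F (\<phi> n)"
    and conv: "AE \<omega> in M. \<forall>T\<ge>0. (\<lambda>n. \<integral>\<^sup>+ s\<in>{0..T}.
        hs_norm_sq Q (\<lambda>u. elementary_wiener_fun (\<phi> n) s \<omega> u - \<Phi> s \<omega> u) \<partial>lborel) \<longlonglongrightarrow> 0"
    and lim: "AE \<omega> in M. \<forall>T\<ge>0. uniform_limit {0..T}
        (\<lambda>n t. elementary_wiener_integral W (\<phi> n) t \<omega>) (\<lambda>t. X t \<omega>) sequentially"
    using X by (rule wiener_integralE) (rule that)
  define \<psi> where "\<psi> n = elementary_wiener_image T (\<phi> n)" for n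
  have "elementary_wiener F (\<psi> n)" for n
    using \<phi>[of n] by (force simp: elementary_wiener_def \<psi>_def elementary_wiener_image_def)
  moreover have "AE \<omega> in M. \<omega> \<in> space M \<longrightarrow> (\<forall>t\<ge>0. (\<lambda>n. \<integral>\<^sup>+ s\<in>{0..t}.
        hs_norm_sq Q (\<lambda>u. elementary_wiener_fun (\<psi> n) s \<omega> u - blinfun_apply T (\<Phi> s \<omega> u))
          \<partial>lborel) \<longlonglongrightarrow> 0)"
    using conv
  proof (eventually_elim, intro impI allI)
    fix \<omega> and t :: real assume \<omega>: "\<omega> \<in> space M" and t: "0 \<le> t"
      and conv: "\<forall>T\<ge>0. (\<lambda>n. \<integral>\<^sup>+ s\<in>{0..T}.
        hs_norm_sq Q (\<lambda>u. elementary_wiener_fun (\<phi> n) s \<omega> u - \<Phi> s \<omega> u) \<partial>lborel) \<longlonglongrightarrow> 0"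
    show "(\<lambda>n. \<integral>\<^sup>+ s\<in>{0..t}.
        hs_norm_sq Q (\<lambda>u. elementary_wiener_fun (\<psi> n) s \<omega> u - blinfun_apply T (\<Phi> s \<omega> u))
          \<partial>lborel) \<longlonglongrightarrow> 0"
    proof (rule tendsto_0_le_cmult[OF _ _ conv[rule_format, OF t]])
      show "(\<integral>\<^sup>+ s\<in>{0..t}.
        hs_norm_sq Q (\<lambda>u. elementary_wiener_fun (\<psi> n) s \<omega> u - blinfun_apply T (\<Phi> s \<omega> u)) \<partial>lborel)
        \<le> ennreal ((norm T)\<^sup>2) * (\<integral>\<^sup>+ s\<in>{0..t}.
        hs_norm_sq Q (\<lambda>u. elementary_wiener_fun (\<phi> n) s \<omega> u - \<Phi> s \<omega> u) \<partial>lborel)" for n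
        unfolding nn_integral_interval \<psi>_def elementary_wiener_fun_image blinfun.diff_right[symmetric]
        by (intro nn_integral_le_cmult wiener_error_measurable[OF M \<Phi> \<omega> t]
          hs_norm_sq_blinfun_image_le)
    qed simp
  qed
  moreover have "AE \<omega> in M. \<forall>t\<ge>0. uniform_limit {0..t}
        (\<lambda>n t. elementary_wiener_integral W (\<psi> n) t \<omega>) (\<lambda>t. blinfun_apply T (X t \<omega>)) sequentially"
    using lim
    by eventually_elim (auto simp: \<psi>_def elementary_wiener_integral_image
        intro!: bounded_linear.uniform_limit[OF blinfun.bounded_linear_right])
  ultimately show ?thesis
    unfolding wiener_integral_def
    using wiener_integrand_blinfun_image[OF M \<Phi>] adapted_blinfun_image[OF \<open>adapted F X\<close>] cont
    by (auto intro!: exI[of _ \<psi>] bounded_linear.continuous_on[OF blinfun.bounded_linear_right])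
qed

lemma wiener_integral_add:
  fixes \<Phi> \<Psi> :: "real \<Rightarrow> 'w \<Rightarrow> 'u::{real_inner, banach, second_countable_topology}
      \<Rightarrow> 'h::{real_normed_vector, second_countable_topology}"
  assumes M: "usual_conditions M F"
    and X: "wiener_integral M F Q W \<Phi> X" and Y: "wiener_integral M F Q W \<Psi> Y"
  shows "wiener_integral M F Q W (\<lambda>s \<omega> u. \<Phi> s \<omega> u + \<Psi> s \<omega> u) (\<lambda>t \<omega>. X t \<omega> + Y t \<omega>)"
proof -
  obtain \<phi> :: "nat \<Rightarrow> ('w, 'u, 'h) elementary_wiener" where
    \<Phi>: "wiener_integrand M F Q \<Phi>" "adapted F X"
    and cont1: "\<And>\<omega>. \<omega> \<in> space M \<Longrightarrow> continuous_on {0..} (\<lambda>t. X t \<omega>)"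
    and \<phi>: "\<And>n. elementary_wiener F (\<phi> n)"
    and conv1: "AE \<omega> in M. \<forall>T\<ge>0. (\<lambda>n. \<integral>\<^sup>+ s\<in>{0..T}.
        hs_norm_sq Q (\<lambda>u. elementary_wiener_fun (\<phi> n) s \<omega> u - \<Phi> s \<omega> u) \<partial>lborel) \<longlonglongrightarrow> 0"
    and lim1: "AE \<omega> in M. \<forall>T\<ge>0. uniform_limit {0..T}
        (\<lambda>n t. elementary_wiener_integral W (\<phi> n) t \<omega>) (\<lambda>t. X t \<omega>) sequentially"
    using X by (rule wiener_integralE) (rule that)
  obtain \<psi> :: "nat \<Rightarrow> ('w, 'u, 'h) elementary_wiener" where
    \<Psi>: "wiener_integrand M F Q \<Psi>" "adapted F Y"
    and cont2: "\<And>\<omega>. \<omega> \<in> space M \<Longrightarrow> continuous_on {0..} (\<lambda>t. Y t \<omega>)"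
    and \<psi>: "\<And>n. elementary_wiener F (\<psi> n)"
    and conv2: "AE \<omega> in M. \<forall>T\<ge>0. (\<lambda>n. \<integral>\<^sup>+ s\<in>{0..T}.
        hs_norm_sq Q (\<lambda>u. elementary_wiener_fun (\<psi> n) s \<omega> u - \<Psi> s \<omega> u) \<partial>lborel) \<longlonglongrightarrow> 0"
    and lim2: "AE \<omega> in M. \<forall>T\<ge>0. uniform_limit {0..T}
        (\<lambda>n t. elementary_wiener_integral W (\<psi> n) t \<omega>) (\<lambda>t. Y t \<omega>) sequentially"
    using Y by (rule wiener_integralE) (rule that)
  have "elementary_wiener F (\<phi> n @ \<psi> n)" for n
    using \<phi>[of n] \<psi>[of n] by (auto simp: elementary_wiener_def)
  moreover have "AE \<omega> in M. \<omega> \<in> space M \<longrightarrow> (\<forall>t\<ge>0. (\<lambda>n. \<integral>\<^sup>+ s\<in>{0..t}.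
        hs_norm_sq Q (\<lambda>u. elementary_wiener_fun (\<phi> n @ \<psi> n) s \<omega> u - (\<Phi> s \<omega> u + \<Psi> s \<omega> u))
          \<partial>lborel) \<longlonglongrightarrow> 0)"
    using conv1 conv2
  proof (eventually_elim, intro impI allI)
    fix \<omega> and t :: real assume \<omega>: "\<omega> \<in> space M" and t: "0 \<le> t"
      and conv1: "\<forall>T\<ge>0. (\<lambda>n. \<integral>\<^sup>+ s\<in>{0..T}.
        hs_norm_sq Q (\<lambda>u. elementary_wiener_fun (\<phi> n) s \<omega> u - \<Phi> s \<omega> u) \<partial>lborel) \<longlonglongrightarrow> 0"
      and conv2: "\<forall>T\<ge>0. (\<lambda>n. \<integral>\<^sup>+ s\<in>{0..T}.
        hs_norm_sq Q (\<lambda>u. elementary_wiener_fun (\<psi> n) s \<omega> u - \<Psi> s \<omega> u) \<partial>lborel) \<longlonglongrightarrow> 0"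
    show "(\<lambda>n. \<integral>\<^sup>+ s\<in>{0..t}.
        hs_norm_sq Q (\<lambda>u. elementary_wiener_fun (\<phi> n @ \<psi> n) s \<omega> u - (\<Phi> s \<omega> u + \<Psi> s \<omega> u))
          \<partial>lborel) \<longlonglongrightarrow> 0"
    proof (rule tendsto_0_le_cmult)
      show "(\<integral>\<^sup>+ s\<in>{0..t}. hs_norm_sq Q
            (\<lambda>u. elementary_wiener_fun (\<phi> n @ \<psi> n) s \<omega> u - (\<Phi> s \<omega> u + \<Psi> s \<omega> u)) \<partial>lborel)
        \<le> 2 * ((\<integral>\<^sup>+ s\<in>{0..t}.
                hs_norm_sq Q (\<lambda>u. elementary_wiener_fun (\<phi> n) s \<omega> u - \<Phi> s \<omega> u) \<partial>lborel)
            + (\<integral>\<^sup>+ s\<in>{0..t}.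
                hs_norm_sq Q (\<lambda>u. elementary_wiener_fun (\<psi> n) s \<omega> u - \<Psi> s \<omega> u) \<partial>lborel))" for n
        unfolding nn_integral_interval elementary_wiener_fun_append add_diff_add
        by (intro nn_integral_le_cmult_add wiener_error_measurable[OF M \<Phi>(1) \<omega> t]
            wiener_error_measurable[OF M \<Psi>(1) \<omega> t] hs_norm_sq_add_le)
      show "(\<lambda>n. (\<integral>\<^sup>+ s\<in>{0..t}.
                hs_norm_sq Q (\<lambda>u. elementary_wiener_fun (\<phi> n) s \<omega> u - \<Phi> s \<omega> u) \<partial>lborel)
            + (\<integral>\<^sup>+ s\<in>{0..t}.
                hs_norm_sq Q (\<lambda>u. elementary_wiener_fun (\<psi> n) s \<omega> u - \<Psi> s \<omega> u) \<partial>lborel)) \<longlonglongrightarrow> 0"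
        using tendsto_add[OF conv1[rule_format, OF t] conv2[rule_format, OF t]] by simp
    qed simp
  qed
  moreover have "AE \<omega> in M. \<forall>t\<ge>0. uniform_limit {0..t}
        (\<lambda>n t. elementary_wiener_integral W (\<phi> n @ \<psi> n) t \<omega>) (\<lambda>t. X t \<omega> + Y t \<omega>) sequentially"
    using lim1 lim2
    by eventually_elim (auto simp: elementary_wiener_integral_append intro!: uniform_limit_add)
  ultimately show ?thesis
    unfolding wiener_integral_def
    using wiener_integrand_add[OF M \<Phi>(1) \<Psi>(1)] adapted_add[OF \<Phi>(2) \<Psi>(2)] cont1 cont2
    by (auto intro!: exI[of _ "\<lambda>n. \<phi> n @ \<psi> n"] continuous_on_add)
qed

section \<open>Linearity of the compensated Poisson integral\<close>

text \<open>The composition of an elementary integrand with a bounded linear operator.\<close>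

definition elementary_poisson_image ::
    "('h::real_normed_vector \<Rightarrow>\<^sub>L 'k::real_normed_vector) \<Rightarrow>
     ('w, 'x, 'h) elementary_poisson \<Rightarrow> ('w, 'x, 'k) elementary_poisson" where
  "elementary_poisson_image T = map (\<lambda>(a, b, A, B, v). (a, b, A, B, blinfun_apply T v))"

lemma elementary_poisson_image_valid:
  "elementary_poisson F \<nu> \<phi> \<Longrightarrow> elementary_poisson F \<nu> (elementary_poisson_image T \<phi>)"
  by (induction \<phi>) (auto simp: elementary_poisson_def elementary_poisson_image_def)

lemma elementary_poisson_fun_image:
  "elementary_poisson_fun (elementary_poisson_image T \<phi>) s \<omega> \<xi>
     = blinfun_apply T (elementary_poisson_fun \<phi> s \<omega> \<xi>)"
  by (induction \<phi>) (auto simp: elementary_poisson_fun_def elementary_poisson_image_def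
      blinfun.add_right blinfun.scaleR_right)

lemma elementary_poisson_integral_image:
  "elementary_poisson_integral \<nu> p (elementary_poisson_image T \<phi>) t \<omega>
     = blinfun_apply T (elementary_poisson_integral \<nu> p \<phi> t \<omega>)"
  by (induction \<phi>) (auto simp: elementary_poisson_integral_def elementary_poisson_image_def
      blinfun.add_right blinfun.scaleR_right)

lemma elementary_poisson_fun_append:
  "elementary_poisson_fun (\<phi> @ \<psi>) s \<omega> \<xi>
     = elementary_poisson_fun \<phi> s \<omega> \<xi> + elementary_poisson_fun \<psi> s \<omega> \<xi>"
  by (simp add: elementary_poisson_fun_def)

lemma elementary_poisson_integral_append:
  "elementary_poisson_integral \<nu> p (\<phi> @ \<psi>) t \<omega>
     = elementary_poisson_integral \<nu> p \<phi> t \<omega> + elementary_poisson_integral \<nu> p \<psi> t \<omega>"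
  by (simp add: elementary_poisson_integral_def)

lemma predictable_section_measurable:
  assumes M: "usual_conditions M F" and \<omega>: "\<omega> \<in> space M"
  shows "(\<lambda>s. (s, \<omega>)) \<in> measurable (restrict_space lborel {0..T}) (predictable_algebra M F)"
  unfolding predictable_algebra_def
proof (rule measurable_measure_of)
  have sub: "A \<subseteq> space M" if "A \<in> sets (F a)" "0 \<le> a" for A a
    using sets.sets_into_space[OF that(1)] usual_conditions_space[OF M that(2)] by simp
  then show "{{0} \<times> A |A. A \<in> sets (F 0)} \<union>
      {{a<..b} \<times> A |a b A. 0 \<le> a \<and> a \<le> b \<and> A \<in> sets (F a)} \<subseteq> Pow ({0..} \<times> space M)"
    by fastforce
  show "(\<lambda>s. (s, \<omega>)) \<in> space (restrict_space lborel {0..T}) \<rightarrow> {0..} \<times> space M"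
    using \<omega> by (auto simp: space_restrict_space)
next
  fix Y assume "Y \<in> {{0} \<times> A |A. A \<in> sets (F 0)} \<union>
      {{a<..b} \<times> A |a b A. 0 \<le> a \<and> a \<le> b \<and> A \<in> sets (F a)}"
  then obtain I A where Y: "Y = I \<times> A" "I \<in> sets borel" by auto
  have "(\<lambda>s. (s, \<omega>)) -` Y \<inter> space (restrict_space lborel {0..T})
      = (if \<omega> \<in> A then {0..T} \<inter> I else {})"
    by (auto simp: Y space_restrict_space)
  then show "(\<lambda>s. (s, \<omega>)) -` Y \<inter> space (restrict_space lborel {0..T})
      \<in> sets (restrict_space lborel {0..T})"
    using Y(2) by (auto simp: sets_restrict_space)
qed

lemma poisson_integrand_section_measurable:
  assumes M: "usual_conditions M F" and c: "poisson_integrand M F \<nu> c" and \<omega>: "\<omega> \<in> space M"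
  shows "(\<lambda>(s, \<xi>). c s \<omega> \<xi>) \<in> borel_measurable (restrict_space lborel {0..T} \<Otimes>\<^sub>M \<nu>)"
proof -
  have "(\<lambda>x. ((fst x, \<omega>), snd x))
      \<in> measurable (restrict_space lborel {0..T} \<Otimes>\<^sub>M \<nu>) (predictable_algebra M F \<Otimes>\<^sub>M \<nu>)"
    by (intro measurable_Pair measurable_snd
        measurable_compose[OF measurable_fst predictable_section_measurable[OF M \<omega>]])
  from measurable_compose[OF this, of "\<lambda>((s, \<omega>), \<xi>). c s \<omega> \<xi>" borel] c show ?thesis
    by (simp add: poisson_integrand_def case_prod_beta')
qed

lemma elementary_poisson_fun_measurable:
  fixes \<phi> :: "('w, 'x, 'h::{real_normed_vector, second_countable_topology}) elementary_poisson"
  assumes "elementary_poisson F \<nu> \<phi>"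
  shows "(\<lambda>(s, \<xi>). elementary_poisson_fun \<phi> s \<omega> \<xi>)
    \<in> borel_measurable (restrict_space lborel {0..T} \<Otimes>\<^sub>M \<nu>)"
  using assms
proof (induction \<phi>)
  case (Cons x \<phi>)
  obtain a b A B v where x: "x = (a, b, A, B, v)" by (cases x)
  have [measurable]: "B \<in> sets \<nu>" using Cons.prems by (simp add: elementary_poisson_def x)
  have [measurable]: "(indicator {a<..b} :: real \<Rightarrow> real) \<in> borel_measurable (restrict_space lborel {0..T})"
    by (rule measurable_restrict_space1) simp
  have "(\<lambda>z. (indicator A \<omega> * indicator {a<..b} (fst z) * indicator B (snd z) :: real) *\<^sub>R v)
      \<in> borel_measurable (restrict_space lborel {0..T} \<Otimes>\<^sub>M \<nu>)"
    by measurable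
  moreover have "(\<lambda>(s, \<xi>). elementary_poisson_fun \<phi> s \<omega> \<xi>)
      \<in> borel_measurable (restrict_space lborel {0..T} \<Otimes>\<^sub>M \<nu>)"
    using Cons by (simp add: elementary_poisson_def)
  ultimately show ?case
    using borel_measurable_add by (fastforce simp: x elementary_poisson_fun_def case_prod_beta')
qed (simp add: elementary_poisson_fun_def case_prod_beta')

lemma nn_integral_interval_blinfun_sq_le:
  fixes g :: "real \<Rightarrow> 'x \<Rightarrow> 'h::real_normed_vector"
  assumes "sigma_finite_measure \<nu>"
    and g: "(\<lambda>(s, \<xi>). g s \<xi>) \<in> borel_measurable (restrict_space lborel {0..t} \<Otimes>\<^sub>M \<nu>)"
  shows "(\<integral>\<^sup>+ s\<in>{0..t}. (\<integral>\<^sup>+ \<xi>. ennreal ((norm (blinfun_apply T (g s \<xi>)))\<^sup>2) \<partial>\<nu>) \<partial>lborel)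
    \<le> ennreal ((norm T)\<^sup>2) * (\<integral>\<^sup>+ s\<in>{0..t}. (\<integral>\<^sup>+ \<xi>. ennreal ((norm (g s \<xi>))\<^sup>2) \<partial>\<nu>) \<partial>lborel)"
proof -
  interpret sigma_finite_measure \<nu> by fact
  have sq: "(\<lambda>(s, \<xi>). ennreal ((norm (g s \<xi>))\<^sup>2)) \<in> borel_measurable (restrict_space lborel {0..t} \<Otimes>\<^sub>M \<nu>)"
    using g by (simp add: case_prod_beta')
  show ?thesis
    unfolding nn_integral_interval
  proof (intro nn_integral_le_cmult borel_measurable_nn_integral sq norm_blinfun_sq_le)
    fix s assume "s \<in> space (restrict_space lborel {0..t})"
    from measurable_Pair2[OF sq this] show "(\<lambda>\<xi>. ennreal ((norm (g s \<xi>))\<^sup>2)) \<in> borel_measurable \<nu>"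
      by simp
  qed
qed

lemma nn_integral_interval_add_sq_le:
  fixes g h :: "real \<Rightarrow> 'x \<Rightarrow> 'h::real_normed_vector"
  assumes "sigma_finite_measure \<nu>"
    and g: "(\<lambda>(s, \<xi>). g s \<xi>) \<in> borel_measurable (restrict_space lborel {0..t} \<Otimes>\<^sub>M \<nu>)"
    and h: "(\<lambda>(s, \<xi>). h s \<xi>) \<in> borel_measurable (restrict_space lborel {0..t} \<Otimes>\<^sub>M \<nu>)"
  shows "(\<integral>\<^sup>+ s\<in>{0..t}. (\<integral>\<^sup>+ \<xi>. ennreal ((norm (g s \<xi> + h s \<xi>))\<^sup>2) \<partial>\<nu>) \<partial>lborel)
    \<le> 2 * ((\<integral>\<^sup>+ s\<in>{0..t}. (\<integral>\<^sup>+ \<xi>. ennreal ((norm (g s \<xi>))\<^sup>2) \<partial>\<nu>) \<partial>lborel)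
      + (\<integral>\<^sup>+ s\<in>{0..t}. (\<integral>\<^sup>+ \<xi>. ennreal ((norm (h s \<xi>))\<^sup>2) \<partial>\<nu>) \<partial>lborel))"
proof -
  interpret sigma_finite_measure \<nu> by fact
  have sq: "(\<lambda>(s, \<xi>). ennreal ((norm (k s \<xi>))\<^sup>2)) \<in> borel_measurable (restrict_space lborel {0..t} \<Otimes>\<^sub>M \<nu>)"
    if "(\<lambda>(s, \<xi>). k s \<xi>) \<in> borel_measurable (restrict_space lborel {0..t} \<Otimes>\<^sub>M \<nu>)"
    for k :: "real \<Rightarrow> 'x \<Rightarrow> 'h"
    using that by (simp add: case_prod_beta')
  show ?thesis
    unfolding nn_integral_interval
  proof (intro nn_integral_le_cmult_add borel_measurable_nn_integral sq g h norm_add_sq_le)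
    fix s assume s: "s \<in> space (restrict_space lborel {0..t})"
    from measurable_Pair2[OF sq[OF g] s] show "(\<lambda>\<xi>. ennreal ((norm (g s \<xi>))\<^sup>2)) \<in> borel_measurable \<nu>"
      by simp
    from measurable_Pair2[OF sq[OF h] s] show "(\<lambda>\<xi>. ennreal ((norm (h s \<xi>))\<^sup>2)) \<in> borel_measurable \<nu>"
      by simp
  qed
qed

lemma poisson_error_measurable:
  fixes c :: "real \<Rightarrow> 'w \<Rightarrow> 'x \<Rightarrow> 'h::{real_normed_vector, second_countable_topology}"
  assumes "usual_conditions M F" "poisson_integrand M F \<nu> c" "elementary_poisson F \<nu> \<phi>"
    and "\<omega> \<in> space M"
  shows "(\<lambda>(s, \<xi>). elementary_poisson_fun \<phi> s \<omega> \<xi> - c s \<omega> \<xi>)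
    \<in> borel_measurable (restrict_space lborel {0..T} \<Otimes>\<^sub>M \<nu>)"
  using borel_measurable_diff[OF elementary_poisson_fun_measurable[OF assms(3)]
      poisson_integrand_section_measurable[OF assms(1,2,4)]]
  by (simp add: case_prod_beta')

lemma poisson_integrand_blinfun_image:
  fixes c :: "real \<Rightarrow> 'w \<Rightarrow> 'x \<Rightarrow> 'h::real_normed_vector"
  assumes M: "usual_conditions M F" and \<nu>: "sigma_finite_measure \<nu>"
    and c: "poisson_integrand M F \<nu> c"
  shows "poisson_integrand M F \<nu> (\<lambda>s \<omega> \<xi>. blinfun_apply T (c s \<omega> \<xi>))"
proof -
  have "AE \<omega> in M. \<forall>t\<ge>0.
      (\<integral>\<^sup>+ s\<in>{0..t}. (\<integral>\<^sup>+ \<xi>. ennreal ((norm (c s \<omega> \<xi>))\<^sup>2) \<partial>\<nu>) \<partial>lborel) < \<infinity>"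
    using c by (simp add: poisson_integrand_def)
  then have "AE \<omega> in M. \<forall>t\<ge>0.
      (\<integral>\<^sup>+ s\<in>{0..t}. (\<integral>\<^sup>+ \<xi>. ennreal ((norm (blinfun_apply T (c s \<omega> \<xi>)))\<^sup>2) \<partial>\<nu>) \<partial>lborel) < \<infinity>"
  proof (rule AE_mp, intro AE_I2 impI allI)
    fix \<omega> and t :: real assume \<omega>: "\<omega> \<in> space M" and t: "0 \<le> t"
      and fin: "\<forall>t\<ge>0. (\<integral>\<^sup>+ s\<in>{0..t}. (\<integral>\<^sup>+ \<xi>. ennreal ((norm (c s \<omega> \<xi>))\<^sup>2) \<partial>\<nu>) \<partial>lborel) < \<infinity>"
    note nn_integral_interval_blinfun_sq_le[OF \<nu> poisson_integrand_section_measurable[OF M c \<omega>],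
        where t = t and T = T]
    also have "ennreal ((norm T)\<^sup>2)
        * (\<integral>\<^sup>+ s\<in>{0..t}. (\<integral>\<^sup>+ \<xi>. ennreal ((norm (c s \<omega> \<xi>))\<^sup>2) \<partial>\<nu>) \<partial>lborel) < \<infinity>"
      using fin t by (simp add: ennreal_mult_less_top)
    finally show "(\<integral>\<^sup>+ s\<in>{0..t}.
        (\<integral>\<^sup>+ \<xi>. ennreal ((norm (blinfun_apply T (c s \<omega> \<xi>)))\<^sup>2) \<partial>\<nu>) \<partial>lborel) < \<infinity>" .
  qed
  moreover have "(\<lambda>((s, \<omega>), \<xi>). blinfun_apply T (c s \<omega> \<xi>))
      \<in> borel_measurable (predictable_algebra M F \<Otimes>\<^sub>M \<nu>)"
  proof -
    have "(\<lambda>((s, \<omega>), \<xi>). c s \<omega> \<xi>) \<in> borel_measurable (predictable_algebra M F \<Otimes>\<^sub>M \<nu>)"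
      using c by (simp add: poisson_integrand_def)
    from blinfun_measurable[OF this, of T] show ?thesis by (simp add: case_prod_beta')
  qed
  ultimately show ?thesis unfolding poisson_integrand_def by (rule conjI[rotated])
qed

lemma poisson_integrand_add:
  fixes c d :: "real \<Rightarrow> 'w \<Rightarrow> 'x \<Rightarrow> 'h::{real_normed_vector, second_countable_topology}"
  assumes M: "usual_conditions M F" and \<nu>: "sigma_finite_measure \<nu>"
    and c: "poisson_integrand M F \<nu> c" and d: "poisson_integrand M F \<nu> d"
  shows "poisson_integrand M F \<nu> (\<lambda>s \<omega> \<xi>. c s \<omega> \<xi> + d s \<omega> \<xi>)"
proof -
  have "AE \<omega> in M. \<forall>t\<ge>0.
      (\<integral>\<^sup>+ s\<in>{0..t}. (\<integral>\<^sup>+ \<xi>. ennreal ((norm (c s \<omega> \<xi>))\<^sup>2) \<partial>\<nu>) \<partial>lborel) < \<infinity>"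
    "AE \<omega> in M. \<forall>t\<ge>0.
      (\<integral>\<^sup>+ s\<in>{0..t}. (\<integral>\<^sup>+ \<xi>. ennreal ((norm (d s \<omega> \<xi>))\<^sup>2) \<partial>\<nu>) \<partial>lborel) < \<infinity>"
    "AE \<omega> in M. \<omega> \<in> space M"
    using c d by (simp_all add: poisson_integrand_def)
  then have "AE \<omega> in M. \<forall>t\<ge>0.
      (\<integral>\<^sup>+ s\<in>{0..t}. (\<integral>\<^sup>+ \<xi>. ennreal ((norm (c s \<omega> \<xi> + d s \<omega> \<xi>))\<^sup>2) \<partial>\<nu>) \<partial>lborel) < \<infinity>"
  proof (eventually_elim, intro impI allI)
    fix \<omega> and t :: real assume \<omega>: "\<omega> \<in> space M" and t: "0 \<le> t"
      and fin: "\<forall>t\<ge>0. (\<integral>\<^sup>+ s\<in>{0..t}. (\<integral>\<^sup>+ \<xi>. ennreal ((norm (c s \<omega> \<xi>))\<^sup>2) \<partial>\<nu>) \<partial>lborel) < \<infinity>"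
        "\<forall>t\<ge>0. (\<integral>\<^sup>+ s\<in>{0..t}. (\<integral>\<^sup>+ \<xi>. ennreal ((norm (d s \<omega> \<xi>))\<^sup>2) \<partial>\<nu>) \<partial>lborel) < \<infinity>"
    note nn_integral_interval_add_sq_le[OF \<nu> poisson_integrand_section_measurable[OF M c \<omega>]
        poisson_integrand_section_measurable[OF M d \<omega>], of t]
    also have "2 * ((\<integral>\<^sup>+ s\<in>{0..t}. (\<integral>\<^sup>+ \<xi>. ennreal ((norm (c s \<omega> \<xi>))\<^sup>2) \<partial>\<nu>) \<partial>lborel)
        + (\<integral>\<^sup>+ s\<in>{0..t}. (\<integral>\<^sup>+ \<xi>. ennreal ((norm (d s \<omega> \<xi>))\<^sup>2) \<partial>\<nu>) \<partial>lborel)) < \<infinity>"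
      using fin t by (simp add: ennreal_mult_less_top)
    finally show "(\<integral>\<^sup>+ s\<in>{0..t}.
        (\<integral>\<^sup>+ \<xi>. ennreal ((norm (c s \<omega> \<xi> + d s \<omega> \<xi>))\<^sup>2) \<partial>\<nu>) \<partial>lborel) < \<infinity>" .
  qed
  moreover have "(\<lambda>((s, \<omega>), \<xi>). c s \<omega> \<xi> + d s \<omega> \<xi>)
      \<in> borel_measurable (predictable_algebra M F \<Otimes>\<^sub>M \<nu>)"
    using c d by (auto simp: poisson_integrand_def case_prod_beta' intro: borel_measurable_add)
  ultimately show ?thesis unfolding poisson_integrand_def by (rule conjI[rotated])
qed

lemma poisson_integralE:
  fixes c :: "real \<Rightarrow> 'w \<Rightarrow> 'x \<Rightarrow> 'h::real_normed_vector"
  assumes "poisson_integral M F \<nu> p c X"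
  obtains \<phi> :: "nat \<Rightarrow> ('w, 'x, 'h) elementary_poisson" where
    "poisson_integrand M F \<nu> c" "adapted F X"
    "\<And>\<omega>. \<omega> \<in> space M \<Longrightarrow> cadlag (\<lambda>t. X t \<omega>)"
    "\<And>n. elementary_poisson F \<nu> (\<phi> n)"
    "AE \<omega> in M. \<forall>T\<ge>0. (\<lambda>n. \<integral>\<^sup>+ s\<in>{0..T}. (\<integral>\<^sup>+ \<xi>.
        ennreal ((norm (elementary_poisson_fun (\<phi> n) s \<omega> \<xi> - c s \<omega> \<xi>))\<^sup>2) \<partial>\<nu>) \<partial>lborel) \<longlonglongrightarrow> 0"
    "AE \<omega> in M. \<forall>T\<ge>0. uniform_limit {0..T}
        (\<lambda>n t. elementary_poisson_integral \<nu> p (\<phi> n) t \<omega>) (\<lambda>t. X t \<omega>) sequentially"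
  using assms unfolding poisson_integral_def
  by (elim conjE exE) (rule that; (assumption | erule (1) bspec | erule spec))

lemma poisson_integral_blinfun_image:
  fixes c :: "real \<Rightarrow> 'w \<Rightarrow> 'x \<Rightarrow> 'h::{real_normed_vector, second_countable_topology}"
  assumes M: "usual_conditions M F" and \<nu>: "sigma_finite_measure \<nu>"
    and X: "poisson_integral M F \<nu> p c X"
  shows "poisson_integral M F \<nu> p (\<lambda>s \<omega> \<xi>. blinfun_apply T (c s \<omega> \<xi>))
    (\<lambda>t \<omega>. blinfun_apply T (X t \<omega>))"
proof -
  obtain \<phi> :: "nat \<Rightarrow> ('w, 'x, 'h) elementary_poisson" where
    c: "poisson_integrand M F \<nu> c" and "adapted F X"
    and cadlag: "\<And>\<omega>. \<omega> \<in> space M \<Longrightarrow> cadlag (\<lambda>t. X t \<omega>)"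
    and \<phi>: "\<And>n. elementary_poisson F \<nu> (\<phi> n)"
    and conv: "AE \<omega> in M. \<forall>T\<ge>0. (\<lambda>n. \<integral>\<^sup>+ s\<in>{0..T}. (\<integral>\<^sup>+ \<xi>.
        ennreal ((norm (elementary_poisson_fun (\<phi> n) s \<omega> \<xi> - c s \<omega> \<xi>))\<^sup>2) \<partial>\<nu>) \<partial>lborel) \<longlonglongrightarrow> 0"
    and lim: "AE \<omega> in M. \<forall>T\<ge>0. uniform_limit {0..T}
        (\<lambda>n t. elementary_poisson_integral \<nu> p (\<phi> n) t \<omega>) (\<lambda>t. X t \<omega>) sequentially"
    using X by (rule poisson_integralE) (rule that)
  define \<psi> where "\<psi> n = elementary_poisson_image T (\<phi> n)" for n
  have "elementary_poisson F \<nu> (\<psi> n)" for n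
    unfolding \<psi>_def by (rule elementary_poisson_image_valid[OF \<phi>])
  moreover have "AE \<omega> in M. \<omega> \<in> space M \<longrightarrow> (\<forall>t\<ge>0. (\<lambda>n. \<integral>\<^sup>+ s\<in>{0..t}. (\<integral>\<^sup>+ \<xi>.
        ennreal ((norm (elementary_poisson_fun (\<psi> n) s \<omega> \<xi> - blinfun_apply T (c s \<omega> \<xi>)))\<^sup>2) \<partial>\<nu>)
          \<partial>lborel) \<longlonglongrightarrow> 0)"
    using conv
  proof (eventually_elim, intro impI allI)
    fix \<omega> and t :: real assume \<omega>: "\<omega> \<in> space M" and t: "0 \<le> t"
      and conv: "\<forall>T\<ge>0. (\<lambda>n. \<integral>\<^sup>+ s\<in>{0..T}. (\<integral>\<^sup>+ \<xi>.
        ennreal ((norm (elementary_poisson_fun (\<phi> n) s \<omega> \<xi> - c s \<omega> \<xi>))\<^sup>2) \<partial>\<nu>) \<partial>lborel) \<longlonglongrightarrow> 0"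
    show "(\<lambda>n. \<integral>\<^sup>+ s\<in>{0..t}. (\<integral>\<^sup>+ \<xi>.
        ennreal ((norm (elementary_poisson_fun (\<psi> n) s \<omega> \<xi> - blinfun_apply T (c s \<omega> \<xi>)))\<^sup>2) \<partial>\<nu>)
          \<partial>lborel) \<longlonglongrightarrow> 0"
      by (rule tendsto_0_le_cmult[OF _ _ conv[rule_format, OF t],
            where c = "ennreal ((norm T)\<^sup>2)"];
          (unfold \<psi>_def elementary_poisson_fun_image blinfun.diff_right[symmetric])?)
         (simp_all add: nn_integral_interval_blinfun_sq_le[OF \<nu> poisson_error_measurable[OF M c \<phi> \<omega>]])
  qed
  moreover have "AE \<omega> in M. \<forall>t\<ge>0. uniform_limit {0..t}
        (\<lambda>n t. elementary_poisson_integral \<nu> p (\<psi> n) t \<omega>) (\<lambda>t. blinfun_apply T (X t \<omega>)) sequentially"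
    using lim
    by eventually_elim (auto simp: \<psi>_def elementary_poisson_integral_image
        intro!: bounded_linear.uniform_limit[OF blinfun.bounded_linear_right])
  ultimately show ?thesis
    unfolding poisson_integral_def
    using poisson_integrand_blinfun_image[OF M \<nu> c] adapted_blinfun_image[OF \<open>adapted F X\<close>] cadlag
    by (auto intro!: exI[of _ \<psi>] cadlag_blinfun_image)
qed

lemma poisson_integral_add:
  fixes c d :: "real \<Rightarrow> 'w \<Rightarrow> 'x \<Rightarrow> 'h::{real_normed_vector, second_countable_topology}"
  assumes M: "usual_conditions M F" and \<nu>: "sigma_finite_measure \<nu>"
    and X: "poisson_integral M F \<nu> p c X" and Y: "poisson_integral M F \<nu> p d Y"
  shows "poisson_integral M F \<nu> p (\<lambda>s \<omega> \<xi>. c s \<omega> \<xi> + d s \<omega> \<xi>) (\<lambda>t \<omega>. X t \<omega> + Y t \<omega>)"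
proof -
  obtain \<phi> :: "nat \<Rightarrow> ('w, 'x, 'h) elementary_poisson" where
    c: "poisson_integrand M F \<nu> c" "adapted F X"
    and cadlag1: "\<And>\<omega>. \<omega> \<in> space M \<Longrightarrow> cadlag (\<lambda>t. X t \<omega>)"
    and \<phi>: "\<And>n. elementary_poisson F \<nu> (\<phi> n)"
    and conv1: "AE \<omega> in M. \<forall>T\<ge>0. (\<lambda>n. \<integral>\<^sup>+ s\<in>{0..T}. (\<integral>\<^sup>+ \<xi>.
        ennreal ((norm (elementary_poisson_fun (\<phi> n) s \<omega> \<xi> - c s \<omega> \<xi>))\<^sup>2) \<partial>\<nu>) \<partial>lborel) \<longlonglongrightarrow> 0"
    and lim1: "AE \<omega> in M. \<forall>T\<ge>0. uniform_limit {0..T}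
        (\<lambda>n t. elementary_poisson_integral \<nu> p (\<phi> n) t \<omega>) (\<lambda>t. X t \<omega>) sequentially"
    using X by (rule poisson_integralE) (rule that)
  obtain \<psi> :: "nat \<Rightarrow> ('w, 'x, 'h) elementary_poisson" where
    d: "poisson_integrand M F \<nu> d" "adapted F Y"
    and cadlag2: "\<And>\<omega>. \<omega> \<in> space M \<Longrightarrow> cadlag (\<lambda>t. Y t \<omega>)"
    and \<psi>: "\<And>n. elementary_poisson F \<nu> (\<psi> n)"
    and conv2: "AE \<omega> in M. \<forall>T\<ge>0. (\<lambda>n. \<integral>\<^sup>+ s\<in>{0..T}. (\<integral>\<^sup>+ \<xi>.
        ennreal ((norm (elementary_poisson_fun (\<psi> n) s \<omega> \<xi> - d s \<omega> \<xi>))\<^sup>2) \<partial>\<nu>) \<partial>lborel) \<longlonglongrightarrow> 0"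
    and lim2: "AE \<omega> in M. \<forall>T\<ge>0. uniform_limit {0..T}
        (\<lambda>n t. elementary_poisson_integral \<nu> p (\<psi> n) t \<omega>) (\<lambda>t. Y t \<omega>) sequentially"
    using Y by (rule poisson_integralE) (rule that)
  have "elementary_poisson F \<nu> (\<phi> n @ \<psi> n)" for n
    using \<phi>[of n] \<psi>[of n] by (auto simp: elementary_poisson_def)
  moreover have "AE \<omega> in M. \<omega> \<in> space M \<longrightarrow> (\<forall>t\<ge>0. (\<lambda>n. \<integral>\<^sup>+ s\<in>{0..t}. (\<integral>\<^sup>+ \<xi>.
        ennreal ((norm (elementary_poisson_fun (\<phi> n @ \<psi> n) s \<omega> \<xi> - (c s \<omega> \<xi> + d s \<omega> \<xi>)))\<^sup>2) \<partial>\<nu>)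
          \<partial>lborel) \<longlonglongrightarrow> 0)"
    using conv1 conv2
  proof (eventually_elim, intro impI allI)
    fix \<omega> and t :: real assume \<omega>: "\<omega> \<in> space M" and t: "0 \<le> t"
      and conv1: "\<forall>T\<ge>0. (\<lambda>n. \<integral>\<^sup>+ s\<in>{0..T}. (\<integral>\<^sup>+ \<xi>.
        ennreal ((norm (elementary_poisson_fun (\<phi> n) s \<omega> \<xi> - c s \<omega> \<xi>))\<^sup>2) \<partial>\<nu>) \<partial>lborel) \<longlonglongrightarrow> 0"
      and conv2: "\<forall>T\<ge>0. (\<lambda>n. \<integral>\<^sup>+ s\<in>{0..T}. (\<integral>\<^sup>+ \<xi>.
        ennreal ((norm (elementary_poisson_fun (\<psi> n) s \<omega> \<xi> - d s \<omega> \<xi>))\<^sup>2) \<partial>\<nu>) \<partial>lborel) \<longlonglongrightarrow> 0"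
    show "(\<lambda>n. \<integral>\<^sup>+ s\<in>{0..t}. (\<integral>\<^sup>+ \<xi>.
        ennreal ((norm (elementary_poisson_fun (\<phi> n @ \<psi> n) s \<omega> \<xi> - (c s \<omega> \<xi> + d s \<omega> \<xi>)))\<^sup>2) \<partial>\<nu>)
          \<partial>lborel) \<longlonglongrightarrow> 0"
      unfolding elementary_poisson_fun_append add_diff_add
      by (rule tendsto_0_le_cmult[OF nn_integral_interval_add_sq_le[OF \<nu>
              poisson_error_measurable[OF M c(1) \<phi> \<omega>] poisson_error_measurable[OF M d(1) \<psi> \<omega>]]])
         (use tendsto_add[OF conv1[rule_format, OF t] conv2[rule_format, OF t]] in simp_all)
  qed
  moreover have "AE \<omega> in M. \<forall>t\<ge>0. uniform_limit {0..t}
        (\<lambda>n t. elementary_poisson_integral \<nu> p (\<phi> n @ \<psi> n) t \<omega>) (\<lambda>t. X t \<omega> + Y t \<omega>) sequentially"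
    using lim1 lim2
    by eventually_elim (auto simp: elementary_poisson_integral_append intro!: uniform_limit_add)
  ultimately show ?thesis
    unfolding poisson_integral_def
    using poisson_integrand_add[OF M \<nu> c(1) d(1)] adapted_add[OF c(2) d(2)] cadlag1 cadlag2
    by (auto intro!: exI[of _ "\<lambda>n. \<phi> n @ \<psi> n"] cadlag_add)
qed

section \<open>Linearity of Ito representations\<close>

lemma ito_representation_blinfun_image:
  fixes a :: "real \<Rightarrow> 'w \<Rightarrow> 'h::{banach, second_countable_topology}"
    and b :: "real \<Rightarrow> 'w \<Rightarrow> 'u::{real_inner, banach, second_countable_topology} \<Rightarrow> 'h"
    and T :: "'h \<Rightarrow>\<^sub>L 'k::{banach, second_countable_topology}"
  assumes M: "usual_conditions M F" and \<nu>: "sigma_finite_measure \<nu>"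
    and X: "ito_representation M F Q W \<nu> p x0 a b c X"
  shows "ito_representation M F Q W \<nu> p (blinfun_apply T x0) (\<lambda>s \<omega>. blinfun_apply T (a s \<omega>))
    (\<lambda>s \<omega> u. blinfun_apply T (b s \<omega> u)) (\<lambda>s \<omega> \<xi>. blinfun_apply T (c s \<omega> \<xi>))
    (\<lambda>t \<omega>. blinfun_apply T (X t \<omega>))"
proof -
  obtain Y Z where a: "drift_integrand M F a" and Y: "wiener_integral M F Q W b Y"
    and Z: "poisson_integral M F \<nu> p c Z"
    and eq: "AE \<omega> in M. \<forall>t\<ge>0. X t \<omega> = x0 + (LINT s:{0..t}|lborel. a s \<omega>) + Y t \<omega> + Z t \<omega>"
    using X unfolding ito_representation_def by (elim conjE exE) (rule that)
  have int: "AE \<omega> in M. \<forall>t\<ge>0. set_integrable lborel {0..t} (\<lambda>s. a s \<omega>)"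
    using a by (simp add: drift_integrand_def)
  have "drift_integrand M F (\<lambda>s \<omega>. blinfun_apply T (a s \<omega>))"
    unfolding drift_integrand_def
  proof
    show "progressive F (\<lambda>s \<omega>. blinfun_apply T (a s \<omega>))"
      using a by (intro progressive_blinfun_image) (simp add: drift_integrand_def)
    show "AE \<omega> in M. \<forall>t\<ge>0. set_integrable lborel {0..t} (\<lambda>s. blinfun_apply T (a s \<omega>))"
      using int by eventually_elim
        (auto simp: set_integrable_def blinfun.scaleR_right[symmetric]
          intro!: integrable_bounded_linear[OF blinfun.bounded_linear_right])
  qed
  moreover have "AE \<omega> in M. \<forall>t\<ge>0. blinfun_apply T (X t \<omega>) = blinfun_apply T x0
      + (LINT s:{0..t}|lborel. blinfun_apply T (a s \<omega>)) + blinfun_apply T (Y t \<omega>) + blinfun_apply T (Z t \<omega>)"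
    using eq int
  proof (eventually_elim, intro allI impI)
    fix \<omega> and t :: real assume "\<forall>t\<ge>0. X t \<omega> = x0 + (LINT s:{0..t}|lborel. a s \<omega>) + Y t \<omega> + Z t \<omega>"
      and "\<forall>t\<ge>0. set_integrable lborel {0..t} (\<lambda>s. a s \<omega>)" and "0 \<le> t"
    then show "blinfun_apply T (X t \<omega>) = blinfun_apply T x0
      + (LINT s:{0..t}|lborel. blinfun_apply T (a s \<omega>)) + blinfun_apply T (Y t \<omega>) + blinfun_apply T (Z t \<omega>)"
      by (simp add: set_lebesgue_integral_def set_integrable_def blinfun.add_right
          integral_bounded_linear[OF blinfun.bounded_linear_right] flip: blinfun.scaleR_right)
  qed
  ultimately show ?thesis
    unfolding ito_representation_def
    using wiener_integral_blinfun_image[OF M Y] poisson_integral_blinfun_image[OF M \<nu> Z]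
    by (intro conjI exI)
qed

lemma ito_representation_add:
  fixes a a' :: "real \<Rightarrow> 'w \<Rightarrow> 'h::{banach, second_countable_topology}"
    and b b' :: "real \<Rightarrow> 'w \<Rightarrow> 'u::{real_inner, banach, second_countable_topology} \<Rightarrow> 'h"
  assumes M: "usual_conditions M F" and \<nu>: "sigma_finite_measure \<nu>"
    and X: "ito_representation M F Q W \<nu> p x0 a b c X"
    and X': "ito_representation M F Q W \<nu> p x0' a' b' c' X'"
  shows "ito_representation M F Q W \<nu> p (x0 + x0') (\<lambda>s \<omega>. a s \<omega> + a' s \<omega>)
    (\<lambda>s \<omega> u. b s \<omega> u + b' s \<omega> u) (\<lambda>s \<omega> \<xi>. c s \<omega> \<xi> + c' s \<omega> \<xi>) (\<lambda>t \<omega>. X t \<omega> + X' t \<omega>)"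
proof -
  obtain Y Z where a: "drift_integrand M F a" and Y: "wiener_integral M F Q W b Y"
    and Z: "poisson_integral M F \<nu> p c Z"
    and eq: "AE \<omega> in M. \<forall>t\<ge>0. X t \<omega> = x0 + (LINT s:{0..t}|lborel. a s \<omega>) + Y t \<omega> + Z t \<omega>"
    using X unfolding ito_representation_def by (elim conjE exE) (rule that)
  obtain Y' Z' where a': "drift_integrand M F a'" and Y': "wiener_integral M F Q W b' Y'"
    and Z': "poisson_integral M F \<nu> p c' Z'"
    and eq': "AE \<omega> in M. \<forall>t\<ge>0. X' t \<omega> = x0' + (LINT s:{0..t}|lborel. a' s \<omega>) + Y' t \<omega> + Z' t \<omega>"
    using X' unfolding ito_representation_def by (elim conjE exE) (rule that)
  have int: "AE \<omega> in M. \<forall>t\<ge>0. set_integrable lborel {0..t} (\<lambda>s. a s \<omega>)"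
    "AE \<omega> in M. \<forall>t\<ge>0. set_integrable lborel {0..t} (\<lambda>s. a' s \<omega>)"
    using a a' by (simp_all add: drift_integrand_def)
  have "drift_integrand M F (\<lambda>s \<omega>. a s \<omega> + a' s \<omega>)"
    unfolding drift_integrand_def
  proof
    show "progressive F (\<lambda>s \<omega>. a s \<omega> + a' s \<omega>)"
      using a a' by (intro progressive_add) (simp_all add: drift_integrand_def)
    show "AE \<omega> in M. \<forall>t\<ge>0. set_integrable lborel {0..t} (\<lambda>s. a s \<omega> + a' s \<omega>)"
      using int by eventually_elim (auto intro: set_integral_add(1))
  qed
  moreover have "AE \<omega> in M. \<forall>t\<ge>0. X t \<omega> + X' t \<omega> = (x0 + x0')
      + (LINT s:{0..t}|lborel. a s \<omega> + a' s \<omega>) + (Y t \<omega> + Y' t \<omega>) + (Z t \<omega> + Z' t \<omega>)"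
    using eq eq' int by eventually_elim (simp add: set_integral_add(2))
  ultimately show ?thesis
    unfolding ito_representation_def
    using wiener_integral_add[OF M Y Y'] poisson_integral_add[OF M \<nu> Z Z']
    by (intro conjI exI)
qed

lemma ito_representation_sum:
  fixes a :: "nat \<Rightarrow> real \<Rightarrow> 'w \<Rightarrow> 'h::{banach, second_countable_topology}"
    and b :: "nat \<Rightarrow> real \<Rightarrow> 'w \<Rightarrow> 'u::{real_inner, banach, second_countable_topology} \<Rightarrow> 'h"
  assumes M: "usual_conditions M F" and \<nu>: "sigma_finite_measure \<nu>"
    and X: "\<And>k. ito_representation M F Q W \<nu> p (x0 k) (a k) (b k) (c k) (X k)"
  shows "ito_representation M F Q W \<nu> p (\<Sum>k<n. x0 k) (\<lambda>s \<omega>. \<Sum>k<n. a k s \<omega>)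
    (\<lambda>s \<omega> u. \<Sum>k<n. b k s \<omega> u) (\<lambda>s \<omega> \<xi>. \<Sum>k<n. c k s \<omega> \<xi>) (\<lambda>t \<omega>. \<Sum>k<n. X k t \<omega>)"
proof (induction n)
  case 0
  \<comment> \<open>the zero process is the image of any Ito process under the zero operator\<close>
  show ?case
    using ito_representation_blinfun_image[OF M \<nu> X, where T = "0 :: 'h \<Rightarrow>\<^sub>L 'h"] by simp
next
  case (Suc n)
  show ?case
    using ito_representation_add[OF M \<nu> Suc.IH X[of n]] by simp
qed

section \<open>Truncated singular value decompositions\<close>

lemma orthonormal_system_norm_sum:
  assumes "orthonormal_system e" "finite I"
  shows "(norm (\<Sum>k\<in>I. c k *\<^sub>R e k))\<^sup>2 = (\<Sum>k\<in>I. (c k)\<^sup>2)"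
proof -
  have "(norm (\<Sum>k\<in>I. c k *\<^sub>R e k))\<^sup>2 = (\<Sum>k\<in>I. (norm (c k *\<^sub>R e k))\<^sup>2)"
    using assms by (intro norm_sum_Pythagorean)
      (auto simp: pairwise_def orthogonal_def orthonormal_system_def)
  also have "\<dots> = (\<Sum>k\<in>I. (c k)\<^sup>2)"
    using assms by (intro sum.cong) (auto simp: orthonormal_system_def norm_eq_sqrt_inner)
  finally show ?thesis .
qed

lemma Bessel_inequality:
  assumes e: "orthonormal_system e" and I: "finite I"
  shows "(\<Sum>k\<in>I. (inner h (e k))\<^sup>2) \<le> (norm h)\<^sup>2"
proof -
  define g where "g = (\<Sum>k\<in>I. inner h (e k) *\<^sub>R e k)"
  have "inner h g = (\<Sum>k\<in>I. (inner h (e k))\<^sup>2)"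
    by (simp add: g_def inner_sum_right power2_eq_square)
  moreover have "(norm g)\<^sup>2 = (\<Sum>k\<in>I. (inner h (e k))\<^sup>2)"
    unfolding g_def by (rule orthonormal_system_norm_sum[OF e I])
  moreover have "(norm (h - g))\<^sup>2 = (norm h)\<^sup>2 - 2 * inner h g + (norm g)\<^sup>2"
    unfolding power2_norm_eq_inner by (simp add: inner_simps inner_commute)
  ultimately show ?thesis using zero_le_power2[of "norm (h - g)"] by linarith
qed

text \<open>Since \<open>n\<close> counts the retained terms and indices start from 0, the largest discarded singular value
  is \<open>s n\<close>.\<close>

lemma svd_truncation_error:
  assumes svd: "singular_value_decomposition \<iota> e f s"
  shows "norm (svd_truncation e f s n h - \<iota> h) \<le> s n * norm h"
proof -
  have e: "orthonormal_system e" and f: "orthonormal_system f" and s0: "\<And>k. 0 \<le> s k"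
    and s: "decseq s" and sums: "(\<lambda>k. (s k * inner h (e k)) *\<^sub>R f k) sums \<iota> h"
    using svd by (auto simp: singular_value_decomposition_def)
  let ?S = "\<lambda>m. \<Sum>k<m. (s k * inner h (e k)) *\<^sub>R f k"
  have "norm (?S n - ?S m) \<le> s n * norm h" if "n \<le> m" for m
  proof (rule power2_le_imp_le)
    have "?S m - ?S n = (\<Sum>k\<in>{n..<m}. (s k * inner h (e k)) *\<^sub>R f k)"
      using that by (simp add: sum_diff_nat_ivl lessThan_atLeast0)
    then have "(norm (?S n - ?S m))\<^sup>2 = (\<Sum>k\<in>{n..<m}. (s k * inner h (e k))\<^sup>2)"
      by (simp add: norm_minus_commute orthonormal_system_norm_sum[OF f])
    also have "\<dots> \<le> (\<Sum>k\<in>{n..<m}. (s n)\<^sup>2 * (inner h (e k))\<^sup>2)"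
      using s s0 by (intro sum_mono) (auto simp: power_mult_distrib decseq_def intro!: mult_right_mono power_mono)
    also have "\<dots> \<le> (s n)\<^sup>2 * (norm h)\<^sup>2"
      by (simp add: sum_distrib_left[symmetric] mult_left_mono Bessel_inequality[OF e])
    finally show "(norm (?S n - ?S m))\<^sup>2 \<le> (s n * norm h)\<^sup>2"
      by (simp add: power_mult_distrib)
  qed (simp add: s0)
  moreover have "(\<lambda>m. norm (?S n - ?S m)) \<longlonglongrightarrow> norm (?S n - \<iota> h)"
    using sums by (intro tendsto_intros) (simp add: sums_def)
  ultimately show ?thesis
    unfolding svd_truncation_def by (intro LIMSEQ_le_const2) auto
qed

lemma bounded_linear_svd_truncation_diff:
  assumes "bounded_linear \<iota>"
  shows "bounded_linear (\<lambda>h. svd_truncation e f s n h - \<iota> h)"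
  unfolding svd_truncation_def
  by (intro bounded_linear_sub assms bounded_linear_sum
      bounded_linear_compose[OF bounded_linear_scaleR_left]
      bounded_linear_compose[OF bounded_linear_mult_right] bounded_linear_inner_left)

lemma onorm_svd_truncation_tendsto_0:
  assumes "bounded_linear \<iota>" and svd: "singular_value_decomposition \<iota> e f s"
  shows "(\<lambda>n. onorm (\<lambda>h. svd_truncation e f s n h - \<iota> h)) \<longlonglongrightarrow> 0"
proof (rule tendsto_sandwich[OF _ _ tendsto_const])
  show "s \<longlonglongrightarrow> 0" using svd by (simp add: singular_value_decomposition_def)
  have "0 \<le> s n" for n using svd by (simp add: singular_value_decomposition_def)
  then show "\<forall>\<^sub>F n in sequentially. onorm (\<lambda>h. svd_truncation e f s n h - \<iota> h) \<le> s n"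
    by (intro always_eventually allI onorm_bound svd_truncation_error[OF svd])
  show "\<forall>\<^sub>F n in sequentially. 0 \<le> onorm (\<lambda>h. svd_truncation e f s n h - \<iota> h)"
    by (intro always_eventually allI onorm_pos_le bounded_linear_svd_truncation_diff assms)
qed

section \<open>Approximation of weak solutions by finite dimensional Ito processes\<close>

theorem proposition3p3:
  fixes \<iota> :: "'h1::{real_inner, banach, second_countable_topology} \<Rightarrow>
              'h2::{real_inner, banach, second_countable_topology}"
    and e :: "nat \<Rightarrow> 'h1" and f :: "nat \<Rightarrow> 'h2" and s :: "nat \<Rightarrow> real"
    and M :: "'w measure" and F :: "real \<Rightarrow> 'w measure"
    and Q :: "'u::{real_inner, banach, second_countable_topology} \<Rightarrow> 'u"
    and W :: "real \<Rightarrow> 'w \<Rightarrow> 'u"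
    and \<nu> :: "'x measure" and p :: "'w \<Rightarrow> (real \<times> 'x) measure"
    and D :: "'h1 set" and A :: "'h1 \<Rightarrow> 'h1"
    and \<alpha> :: "real \<Rightarrow> 'h1 \<Rightarrow> 'h1"
    and \<sigma> :: "real \<Rightarrow> 'h1 \<Rightarrow> 'u \<Rightarrow> 'h1"
    and \<delta> :: "real \<Rightarrow> 'h1 \<Rightarrow> 'x \<Rightarrow> 'h1"
    and \<epsilon> :: "nat \<Rightarrow> real"
  assumes "compact_operator \<iota>" and "inj \<iota>"
    and "singular_value_decomposition \<iota> e f s"
    and "usual_conditions M F"
    and "wiener_process M F Q W"
    and "poisson_random_measure M F \<nu> p"
    and "C0_generator D A"
    and "measurable_coefficients Q \<nu> \<alpha> \<sigma> \<delta>"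
    and "lipschitz_coefficients Q \<nu> \<alpha> \<sigma> \<delta>"
    and "unique_weak_solutions M F Q W \<nu> p D A \<alpha> \<sigma> \<delta>"
    and "\<And>n. 0 < \<epsilon> n" and "decseq \<epsilon>" and "\<epsilon> \<longlonglongrightarrow> 0"
  shows "\<forall>h0 r. weak_solution M F Q W \<nu> p D A \<alpha> \<sigma> \<delta> h0 r \<longrightarrow>
    (\<exists>rn :: nat \<Rightarrow> real \<Rightarrow> 'w \<Rightarrow> 'h2.
       (\<forall>n. ito_process M F Q W \<nu> p (svd_space f n) (rn n)) \<and>
       (AE \<omega> in M. \<forall>t\<ge>0. \<forall>n.
          norm (rn n t \<omega> - \<iota> (r t \<omega>))
            \<le> (onorm (\<lambda>h. svd_truncation e f s n h - \<iota> h) + \<epsilon> n) * norm (r t \<omega>)) \<and>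
       (\<forall>t\<ge>0. \<forall>\<omega>\<in>space M.
          (\<lambda>n. (onorm (\<lambda>h. svd_truncation e f s n h - \<iota> h) + \<epsilon> n) * norm (r t \<omega>))
            \<longlonglongrightarrow> 0))"
proof (intro allI impI)
  fix h0 :: 'h1 and r assume r: "weak_solution M F Q W \<nu> p D A \<alpha> \<sigma> \<delta> h0 r"
  note svd = assms(3) and M = assms(4) and \<epsilon> = assms(11)
  have \<iota>: "bounded_linear \<iota>" using assms(1) by (simp add: compact_operator_def)
  have \<nu>: "sigma_finite_measure \<nu>" using assms(6) by (simp add: poisson_random_measure_def)
  have s0: "0 \<le> s k" and f1: "norm (f k) = 1" for k
    using svd by (auto simp: singular_value_decomposition_def orthonormal_system_def norm_eq_sqrt_inner)
  have S0: "0 \<le> (\<Sum>k<n. s k)" for n by (intro sum_nonneg s0)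
  \<comment> \<open>the tolerance for replacing \<open>e k\<close>; the errors \<open>s k * d n\<close> for \<open>k < n\<close> add up to at most \<open>\<epsilon> n\<close>\<close>
  define d where "d n = \<epsilon> n / (1 + (\<Sum>k<n. s k))" for n
  have d0: "0 < d n" for n using \<epsilon>[of n] S0[of n] by (simp add: d_def)
  have approx: "\<exists>\<zeta>\<in>adjoint_domain D A. dist \<zeta> (e k) < d n" for n k
    using C0_generator_adjoint_domain_dense[OF assms(7)] d0[of n]
      closure_approachable[of "e k" "adjoint_domain D A"] by simp
  define \<zeta> where "\<zeta> n k = (SOME x. x \<in> adjoint_domain D A \<and> norm (x - e k) < d n)" for n k
  have "\<zeta> n k \<in> adjoint_domain D A \<and> norm (\<zeta> n k - e k) < d n" for n k
    unfolding \<zeta>_def by (rule someI_ex) (use approx[of k n] in \<open>simp add: dist_norm Bex_def\<close>)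
  then have \<zeta>: "\<zeta> n k \<in> adjoint_domain D A" "norm (\<zeta> n k - e k) < d n" for n k
    by simp_all
  \<comment> \<open>the real-valued processes are mapped to the line through \<open>f k\<close> by \<open>J k\<close>\<close>
  define J where "J k = blinfun_scaleR_left (s k *\<^sub>R f k)" for k
  define rn where "rn n t \<omega> = (\<Sum>k<n. blinfun_apply (J k) (inner (\<zeta> n k) (r t \<omega>)))" for n t \<omega>
  have span: "(\<Sum>k<n. blinfun_apply (J k) (x k)) \<in> svd_space f n" for n x
    unfolding svd_space_def J_def blinfun_scaleR_left.rep_eq
    by (intro span_sum span_scale span_base imageI)
  have ito: "ito_process M F Q W \<nu> p (svd_space f n) (rn n)" for n
  proof -
    define a where "a k u \<omega> = inner (adjoint_operator D A (\<zeta> n k)) (r u \<omega>)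
        + inner (\<zeta> n k) (\<alpha> u (r u \<omega>))" for k u \<omega>
    define b where "b k u \<omega> v = inner (\<zeta> n k) (\<sigma> u (r u \<omega>) v)" for k u \<omega> v
    define c where "c k u \<omega> \<xi> = inner (\<zeta> n k) (\<delta> u (left_limit (\<lambda>t. r t \<omega>) u) \<xi>)" for k u \<omega> \<xi>
    have scalar: "ito_representation M F Q W \<nu> p (inner (\<zeta> n k) h0) (a k) (b k) (c k)
        (\<lambda>t \<omega>. inner (\<zeta> n k) (r t \<omega>))" for k
      using r \<zeta>(1) by (simp add: weak_solution_def a_def[abs_def] b_def[abs_def] c_def[abs_def])
    have "ito_representation M F Q W \<nu> p (blinfun_apply (J k) (inner (\<zeta> n k) h0))
        (\<lambda>u \<omega>. blinfun_apply (J k) (a k u \<omega>)) (\<lambda>u \<omega> v. blinfun_apply (J k) (b k u \<omega> v))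
        (\<lambda>u \<omega> \<xi>. blinfun_apply (J k) (c k u \<omega> \<xi>))
        (\<lambda>t \<omega>. blinfun_apply (J k) (inner (\<zeta> n k) (r t \<omega>)))" for k
      by (rule ito_representation_blinfun_image[OF M \<nu> scalar])
    note rep = ito_representation_sum[OF M \<nu> this, where n = n]
    show ?thesis
      unfolding ito_process_def rn_def
    proof (rule conjI)
      show "\<exists>x0 a b c. x0 \<in> svd_space f n \<and>
          (\<forall>u\<ge>0. \<forall>\<omega>\<in>space M. a u \<omega> \<in> svd_space f n) \<and>
          (\<forall>u\<ge>0. \<forall>\<omega>\<in>space M. \<forall>v. b u \<omega> (operator_sqrt Q v) \<in> svd_space f n) \<and>
          (\<forall>u\<ge>0. \<forall>\<omega>\<in>space M. \<forall>\<xi>\<in>space \<nu>. c u \<omega> \<xi> \<in> svd_space f n) \<and>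
          ito_representation M F Q W \<nu> p x0 a b c
            (\<lambda>t \<omega>. \<Sum>k<n. blinfun_apply (J k) (inner (\<zeta> n k) (r t \<omega>)))"
        by (rule exI[of _ "\<Sum>k<n. blinfun_apply (J k) (inner (\<zeta> n k) h0)"],
            rule exI[of _ "\<lambda>u \<omega>. \<Sum>k<n. blinfun_apply (J k) (a k u \<omega>)"],
            rule exI[of _ "\<lambda>u \<omega> v. \<Sum>k<n. blinfun_apply (J k) (b k u \<omega> v)"],
            rule exI[of _ "\<lambda>u \<omega> \<xi>. \<Sum>k<n. blinfun_apply (J k) (c k u \<omega> \<xi>)"])
           (intro conjI allI ballI impI span rep)
    qed (intro allI ballI impI span)
  qed
  have error: "norm (rn n t \<omega> - \<iota> (r t \<omega>))
      \<le> (onorm (\<lambda>h. svd_truncation e f s n h - \<iota> h) + \<epsilon> n) * norm (r t \<omega>)" for n t \<omega>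
  proof -
    have "rn n t \<omega> - svd_truncation e f s n (r t \<omega>)
        = (\<Sum>k<n. (s k * inner (\<zeta> n k - e k) (r t \<omega>)) *\<^sub>R f k)"
      by (simp add: rn_def svd_truncation_def J_def inner_diff_left inner_commute
          sum_subtractf algebra_simps)
    also have "norm \<dots> \<le> (\<Sum>k<n. s k * (d n * norm (r t \<omega>)))"
    proof (rule sum_norm_le)
      fix k
      have "\<bar>inner (\<zeta> n k - e k) (r t \<omega>)\<bar> \<le> norm (\<zeta> n k - e k) * norm (r t \<omega>)"
        by (rule Cauchy_Schwarz_ineq2)
      also have "\<dots> \<le> d n * norm (r t \<omega>)"
        using \<zeta>(2)[of n k] by (intro mult_right_mono) auto
      finally show "norm ((s k * inner (\<zeta> n k - e k) (r t \<omega>)) *\<^sub>R f k) \<le> s k * (d n * norm (r t \<omega>))"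
        using s0[of k] by (simp add: f1 abs_mult mult_left_mono)
    qed
    also have "\<dots> = ((\<Sum>k<n. s k) * d n) * norm (r t \<omega>)"
      by (simp add: sum_distrib_right mult.assoc)
    also have "\<dots> \<le> \<epsilon> n * norm (r t \<omega>)"
    proof (rule mult_right_mono)
      show "(\<Sum>k<n. s k) * d n \<le> \<epsilon> n"
        using S0[of n] \<epsilon>[of n] by (simp add: d_def field_simps)
    qed simp
    finally have "norm (rn n t \<omega> - svd_truncation e f s n (r t \<omega>)) \<le> \<epsilon> n * norm (r t \<omega>)" .
    moreover have "norm (svd_truncation e f s n (r t \<omega>) - \<iota> (r t \<omega>))
        \<le> onorm (\<lambda>h. svd_truncation e f s n h - \<iota> h) * norm (r t \<omega>)"
      by (rule onorm[OF bounded_linear_svd_truncation_diff[OF \<iota>]])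
    ultimately show ?thesis
      using norm_triangle_ineq[of "rn n t \<omega> - svd_truncation e f s n (r t \<omega>)"
          "svd_truncation e f s n (r t \<omega>) - \<iota> (r t \<omega>)"]
      by (simp add: distrib_right)
  qed
  have "(\<lambda>n. (onorm (\<lambda>h. svd_truncation e f s n h - \<iota> h) + \<epsilon> n) * norm (r t \<omega>)) \<longlonglongrightarrow> (0 + 0) * norm (r t \<omega>)"
    for t \<omega>
    by (intro tendsto_intros onorm_svd_truncation_tendsto_0[OF \<iota> svd] assms(13))
  then show "\<exists>rn :: nat \<Rightarrow> real \<Rightarrow> 'w \<Rightarrow> 'h2.
       (\<forall>n. ito_process M F Q W \<nu> p (svd_space f n) (rn n)) \<and>
       (AE \<omega> in M. \<forall>t\<ge>0. \<forall>n.
          norm (rn n t \<omega> - \<iota> (r t \<omega>))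
            \<le> (onorm (\<lambda>h. svd_truncation e f s n h - \<iota> h) + \<epsilon> n) * norm (r t \<omega>)) \<and>
       (\<forall>t\<ge>0. \<forall>\<omega>\<in>space M.
          (\<lambda>n. (onorm (\<lambda>h. svd_truncation e f s n h - \<iota> h) + \<epsilon> n) * norm (r t \<omega>))
            \<longlonglongrightarrow> 0)"
    using ito error by (intro exI[of _ rn]) simp
qed

end
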